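(* Let $1/2<p<1$, $q=1-p$, and let $(D_n)$ be the sequence of typical depths in a growing random PATRICIA trie with bias $p$, defined on one probability space as in the context. Then $D_n/\log n$ converges in probability to $1/h(p)$, where $h(p)=-p\log p-q\log q$, but it does not converge almost surely. In fact, almost surely, $$\liminf_{n\to\infty}\frac{D_n}{\log n}=\frac1{\log(1/q)},\qquad \limsup_{n\to\infty}\frac{D_n}{\log n}=\frac1{\log(1/p)}.$$
   Context: $\log$ is the natural logarithm. A trie built on distinct infinite binary strings is the binary tree in which each string is stored at a leaf determined by its shortest prefix that distinguishes it from all the other strings; the PATRICIA trie is obtained from the trie by compressing all non-branching paths, so that every internal node has exactly two children. Common probability space: let $S_1,S_2,\dots$ be independent infinite strings, each consisting of i.i.d. $\mathrm{Bernoulli}(p)$ bits. $T_0$ is the empty tree and $T_{n+1}$ is obtained from $T_n$ by inserting $S_{n+1}$; thus $T_n$ is the PATRICIA trie built on $S_1,\dots,S_n$. For each $n\ge1$, $D_n$ is the depth (number of edges from the root) of a leaf of $T_n$ chosen uniformly at random among the $n$ leaves, independently of everything else (in particular of the choices made for other values of $n$). In terms of the Rényi problem, $D_n$ is the number of queries needed to recover a uniformly random element of a bijection between two sets of $n$ elements, when each label is included in a query independently with probability $p$ and queries that fail to split some non-singleton class of the current partition are redrawn on that class until they split it. *)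

theory Defs
  imports "HOL-Probability.Probability"
begin

datatype 'i bintree =
  Empty
| Stored 'i
| Branch "'i bintree" "'i bintree"

primrec leaves :: "'i bintree \<Rightarrow> 'i set" where
  "leaves Empty = {}"
| "leaves (Stored i) = {i}"
| "leaves (Branch l r) = leaves l \<union> leaves r"

text \<open>The number of edges from the root to the leaf labelled \<open>i\<close>.
  The value is arbitrary if there is no such leaf.\<close>

primrec leaf_depth :: "'i bintree \<Rightarrow> 'i \<Rightarrow> nat" where
  "leaf_depth Empty i = 0"
| "leaf_depth (Stored j) i = 0"
| "leaf_depth (Branch l r) i = Suc (if i \<in> leaves l then leaf_depth l i else leaf_depth r i)"

lemma finite_distinguishing_length:
  fixes f :: "'i \<Rightarrow> bool stream"
  assumes "finite I" "inj_on f I"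
  shows "\<exists>m. inj_on (\<lambda>i. stake m (f i)) I"
proof -
  have "\<exists>k. f i !! k \<noteq> f j !! k" if "i \<in> I" "j \<in> I" "i \<noteq> j" for i j
  proof (rule ccontr)
    assume "\<not> ?thesis"
    then have "smap id (f i) = f j"
      by (subst smap_alt) simp
    then have "f i = f j"
      by (simp add: stream.map_id)
    with that assms(2) show False
      by (auto dest: inj_onD)
  qed
  then obtain k where k: "\<And>i j. i \<in> I \<Longrightarrow> j \<in> I \<Longrightarrow> i \<noteq> j \<Longrightarrow> f i !! k i j \<noteq> f j !! k i j"
    by metis
  define m where "m = Suc (Max (insert 0 ((\<lambda>(i, j). k i j) ` (I \<times> I))))"
  have m: "k i j < m" if "i \<in> I" "j \<in> I" for i j
  proof -
    have "(\<lambda>(i, j). k i j) (i, j) \<in> (\<lambda>(i, j). k i j) ` (I \<times> I)"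
      using that by (intro imageI) simp
    then show ?thesis
      using assms(1) by (simp add: m_def less_Suc_eq_le)
  qed
  have "inj_on (\<lambda>i. stake m (f i)) I"
  proof (rule inj_onI, rule ccontr)
    fix i j
    assume ij: "i \<in> I" "j \<in> I" "stake m (f i) = stake m (f j)" "i \<noteq> j"
    then have "stake m (f i) ! k i j = stake m (f j) ! k i j"
      by simp
    with k[OF ij(1,2,4)] m[OF ij(1,2)] show False
      by (simp add: stake_nth)
  qed
  then show ?thesis ..
qed

text \<open>
  The trie of the strings \<open>f i\<close>, \<open>i \<in> I\<close>, where a leaf is labelled by the index of the string
  stored there.  \<open>False\<close> bits lead to the left.  The construction only makes sense for finitely
  many, pairwise distinct strings; otherwise we return the empty tree.
  See \<open>leaf_depth_trie\<close> below for the relation to distinguishing prefixes.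
\<close>

function trie :: "('i \<Rightarrow> bool stream) \<Rightarrow> 'i set \<Rightarrow> 'i bintree" where
  "trie f I =
    (if infinite I \<or> \<not> inj_on f I \<or> I = {} then Empty
     else if card I = 1 then Stored (the_elem I)
     else Branch (trie (\<lambda>i. stl (f i)) {i \<in> I. \<not> shd (f i)})
                 (trie (\<lambda>i. stl (f i)) {i \<in> I. shd (f i)}))"
  by pat_completeness auto
termination
proof -
  have *: "(LEAST m. inj_on (\<lambda>i. stake m (stl (f i))) {i \<in> I. shd (f i) = b})
          < (LEAST m. inj_on (\<lambda>i. stake m (f i)) I)"
    if I: "finite I" "inj_on f I" "I \<noteq> {}" "card I \<noteq> 1" for f :: "'i \<Rightarrow> bool stream" and I b
  proof -
    define m where "m = (LEAST m. inj_on (\<lambda>i. stake m (f i)) I)"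
    have m: "inj_on (\<lambda>i. stake m (f i)) I"
      unfolding m_def by (rule LeastI_ex) (rule finite_distinguishing_length[OF I(1,2)])
    obtain i j where "i \<in> I" "j \<in> I" "i \<noteq> j"
      using I by (metis is_singletonI' is_singleton_altdef)
    with m obtain k where k: "m = Suc k"
      by (cases m) (auto dest: inj_onD)
    have "inj_on (\<lambda>i. stake k (stl (f i))) {i \<in> I. shd (f i) = b}"
      using m unfolding k by (auto simp: inj_on_def)
    then have "(LEAST m. inj_on (\<lambda>i. stake m (stl (f i))) {i \<in> I. shd (f i) = b}) \<le> k"
      by (rule Least_le)
    then show ?thesis
      using k by (simp add: m_def)
  qed
  show ?thesis
  proof (relation "Wellfounded.measure (\<lambda>(f, I). LEAST m. inj_on (\<lambda>i. stake m (f i)) I)", goal_cases)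
    case 1
    show ?case by simp
  next
    case (2 f I)
    then show ?case
      using *[of I f False] by (simp del: One_nat_def)
  next
    case (3 f I)
    then show ?case
      using *[of I f True] by (simp del: One_nat_def)
  qed
qed

declare trie.simps [simp del]

lemma trie_Branch:
  assumes "finite I" "inj_on f I" "I \<noteq> {}" "card I \<noteq> 1"
  shows "trie f I = Branch (trie (\<lambda>i. stl (f i)) {i \<in> I. \<not> shd (f i)})
                           (trie (\<lambda>i. stl (f i)) {i \<in> I. shd (f i)})"
  using assms by (subst trie.simps) (simp del: One_nat_def)

lemma inj_on_stl:
  assumes "inj_on f I"
  shows "inj_on (\<lambda>i. stl (f i)) {i \<in> I. shd (f i)}"
    and "inj_on (\<lambda>i. stl (f i)) {i \<in> I. \<not> shd (f i)}"
proof -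
  have "f i = f j \<longleftrightarrow> shd (f i) = shd (f j) \<and> stl (f i) = stl (f j)" for i j
    using stream.expand by auto
  with assms show "inj_on (\<lambda>i. stl (f i)) {i \<in> I. shd (f i)}"
    and "inj_on (\<lambda>i. stl (f i)) {i \<in> I. \<not> shd (f i)}"
    by (simp_all add: inj_on_def)
qed

lemma leaves_trie:
  assumes "finite I" "inj_on f I"
  shows "leaves (trie f I) = I"
  using assms
proof (induction f I rule: trie.induct)
  case (1 f I)
  show ?case
  proof (cases "I = {} \<or> card I = 1")
    case True
    then show ?thesis
      using 1(3,4) by (subst trie.simps) (auto simp: card_1_singleton_iff)
  next
    case False
    with 1(3,4) have I: "\<not> (infinite I \<or> \<not> inj_on f I \<or> I = {})" "card I \<noteq> 1"
      by simp_all
    have fin: "finite {i \<in> I. P i}" for P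
      using 1(3) by simp
    have "trie f I = Branch (trie (\<lambda>i. stl (f i)) {i \<in> I. \<not> shd (f i)})
                           (trie (\<lambda>i. stl (f i)) {i \<in> I. shd (f i)})"
      using I by (intro trie_Branch) blast+
    then have "leaves (trie f I) = leaves (trie (\<lambda>i. stl (f i)) {i \<in> I. \<not> shd (f i)})
        \<union> leaves (trie (\<lambda>i. stl (f i)) {i \<in> I. shd (f i)})"
      by simp
    then show ?thesis
      unfolding 1(1)[OF I fin inj_on_stl(2)[OF 1(4)]]
        1(2)[OF I fin inj_on_stl(1)[OF 1(4)]] by auto
  qed
qed

lemma leaf_depth_trie:
  assumes "finite I" "inj_on f I" "i \<in> I"
  shows "leaf_depth (trie f I) i = (LEAST m. \<forall>j\<in>I - {i}. stake m (f j) \<noteq> stake m (f i))"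
  using assms
proof (induction f I rule: trie.induct)
  case (1 f I)
  show ?case
  proof (cases "card I = 1")
    case True
    then obtain a where "I = {a}"
      by (auto simp: card_1_singleton_iff)
    then show ?thesis
      using 1(5) by (subst trie.simps) simp
  next
    case False
    with 1(3-5) have I: "\<not> (infinite I \<or> \<not> inj_on f I \<or> I = {})" "card I \<noteq> 1"
      by auto
    let ?g = "\<lambda>j. stl (f j)" and ?J = "{j \<in> I. shd (f j) = shd (f i)}"
    let ?P = "\<lambda>m. \<forall>j\<in>I - {i}. stake m (f j) \<noteq> stake m (f i)"
    have fin: "finite {i \<in> I. P i}" for P
      using 1(3) by simp
    have split: "trie f I = Branch (trie ?g {i \<in> I. \<not> shd (f i)}) (trie ?g {i \<in> I. shd (f i)})"
      using I by (intro trie_Branch) blast+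
    have "leaf_depth (trie f I) i =
        Suc (LEAST m. \<forall>j\<in>?J - {i}. stake m (?g j) \<noteq> stake m (?g i))"
    proof (cases "shd (f i)")
      case True
      then show ?thesis
        using 1(2)[OF I fin inj_on_stl(1)[OF 1(4)]] 1(5)
        by (simp add: split leaves_trie[OF fin inj_on_stl(2)[OF 1(4)]])
    next
      case False
      then show ?thesis
        using 1(1)[OF I fin inj_on_stl(2)[OF 1(4)]] 1(5)
        by (simp add: split leaves_trie[OF fin inj_on_stl(2)[OF 1(4)]])
    qed
    also have "(\<lambda>m. \<forall>j\<in>?J - {i}. stake m (?g j) \<noteq> stake m (?g i)) = (\<lambda>m. ?P (Suc m))"
      by (rule ext) auto
    also have "Suc (LEAST m. ?P (Suc m)) = (LEAST m. ?P m)"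
    proof -
      obtain m where m: "inj_on (\<lambda>i. stake m (f i)) I"
        using finite_distinguishing_length[OF 1(3,4)] ..
      have "?P m"
        using m 1(5) by (blast dest: inj_onD)
      moreover have "\<not> ?P 0"
      proof
        assume "?P 0"
        then have "I \<subseteq> {i}"
          by auto
        with 1(5) have "I = {i}"
          by blast
        then have "card I = 1"
          by simp
        with I(2) show False ..
      qed
      ultimately show ?thesis
        by (rule Least_Suc[symmetric])
    qed
    finally show ?thesis .
  qed
qed

text \<open>Removal of all inner nodes that have only one nonempty subtree\<close>

fun compress :: "'i bintree \<Rightarrow> 'i bintree" where
  "compress Empty = Empty"
| "compress (Stored i) = Stored i"
| "compress (Branch l r) =
    (if compress l = Empty then compress r
     else if compress r = Empty then compress l
     else Branch (compress l) (compress r))"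

definition patricia :: "('i \<Rightarrow> bool stream) \<Rightarrow> 'i set \<Rightarrow> 'i bintree" where
  "patricia f I = compress (trie f I)"

text \<open>
  \<open>S 1\<close>, \<open>S 2\<close>, \dots\ are the random strings, and \<open>U n\<close> is the index of the string stored at the
  leaf chosen from the tree on \<open>S 1\<close>, \dots, \<open>S n\<close>.  The values \<open>S 0\<close> and \<open>U 0\<close> are irrelevant.
  The library's \<open>indep_vars\<close> requires all variables to have the same type, so
  joint independence is stated in terms of the \<open>\<sigma>\<close>-algebras generated by the variables.
\<close>

locale random_patricia = prob_space M
  for M :: "'a measure" and p :: real
    and S :: "nat \<Rightarrow> 'a \<Rightarrow> bool stream" and U :: "nat \<Rightarrow> 'a \<Rightarrow> nat" +
  assumes S_measurable: "\<And>i. i \<ge> 1 \<Longrightarrow> S i \<in> measurable M (stream_space (count_space UNIV))"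
    and U_measurable: "\<And>n. n \<ge> 1 \<Longrightarrow> U n \<in> measurable M (count_space UNIV)"
    and S_distr: "\<And>i. i \<ge> 1 \<Longrightarrow>
      distr M (stream_space (count_space UNIV)) (S i) =
      stream_space (measure_pmf (bernoulli_pmf p))"
    and U_distr: "\<And>n. n \<ge> 1 \<Longrightarrow>
      distr M (count_space UNIV) (U n) = measure_pmf (pmf_of_set {1..n})"
    and indep: "indep_sets
      (case_sum
        (\<lambda>i. {S i -` A \<inter> space M | A. A \<in> sets (stream_space (count_space UNIV))})
        (\<lambda>n. {U n -` A \<inter> space M | A. A \<in> sets (count_space UNIV)}))
      ({1..} <+> {1..})"

definition typical_depth ::
  "(nat \<Rightarrow> 'a \<Rightarrow> bool stream) \<Rightarrow> (nat \<Rightarrow> 'a \<Rightarrow> nat) \<Rightarrow> nat \<Rightarrow> 'a \<Rightarrow> nat"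
where
  "typical_depth S U n \<omega> = leaf_depth (patricia (\<lambda>i. S i \<omega>) {1..n}) (U n \<omega>)"

text \<open>Measurability is included since \<open>measure M A = 0\<close> for nonmeasurable \<open>A\<close>.\<close>

definition converges_in_probability :: "'a measure \<Rightarrow> (nat \<Rightarrow> 'a \<Rightarrow> real) \<Rightarrow> real \<Rightarrow> bool" where
  "converges_in_probability M X c \<longleftrightarrow>
    (\<forall>n. X n \<in> borel_measurable M) \<and>
    (\<forall>\<epsilon>>0. (\<lambda>n. measure M {\<omega> \<in> space M. \<bar>X n \<omega> - c\<bar> > \<epsilon>}) \<longlonglongrightarrow> 0)"

definition bernoulli_entropy :: "real \<Rightarrow> real" where
  "bernoulli_entropy p = - p * ln p - (1 - p) * ln (1 - p)"

end

theory Submission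
  imports Defs "HOL-Real_Asymp.Real_Asymp"
begin

text \<open>
  The depth of a leaf of the PATRICIA trie is the number of levels at which some other string
  leaves the path of the leaf (\<open>leaf_depth_patricia\<close>).  So everything depends on how many of
  the \<open>n\<close> strings share a given prefix.  Write \<open>\<pi> w\<close> for the probability that a string starts
  with the word \<open>w\<close>, so that about \<open>n * \<pi> w\<close> strings do.  While this is a positive power of
  \<open>n\<close>, all levels along \<open>w\<close> branch (\<open>outer_le_gap\<close>); once it is a negative power of \<open>n\<close>,
  hardly any further branching happens (\<open>outer_le_crowd\<close>).  The depth of a leaf is therefore the
  length at which the prefix of its string reaches probability about \<open>1 / n\<close>.

  For a uniformly chosen leaf the prefix is typical: by the asymptotic equipartition property, a
  prefix of length \<open>k\<close> has probability about \<open>exp (- h * k)\<close>, where \<open>h\<close> is the entropy of a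
  bit.  This gives convergence in probability to \<open>1 / h\<close>.

  The extreme prefixes are the runs of the unlikely bit, with probability \<open>exp (- \<nu> * k)\<close>,
  and the runs of the likely bit, with probability \<open>exp (- \<mu> * k)\<close>, where
  \<open>\<nu> = ln (1 / (1 - p))\<close> and \<open>\<mu> = ln (1 / p)\<close>.  All depths thus lie essentially between
  \<open>ln n / \<nu>\<close> and \<open>ln n / \<mu>\<close>.  The two tail bounds can be made summable in \<open>n\<close>, which gives the
  almost sure inequalities \<open>AE_eventually_depth_ge\<close> and \<open>AE_eventually_depth_less\<close>.

  Both extremes are approached again and again, since every \<open>n\<close> brings a fresh independent choice
  of the leaf.  A proportion of about \<open>n powr (- \<alpha>)\<close> of the strings, where \<open>\<alpha> < 1\<close>, starts
  with a run whose probability is \<open>n powr (- \<alpha>)\<close>.  Each choice hits this set with that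
  probability, and these probabilities have a divergent sum.  Indeed, a hit occurs within any block
  \<open>N \<le> n < 2 * N\<close> with probability tending to 1 (\<open>outer_le_no_hit\<close>).  With \<open>\<alpha>\<close> close to 1, a
  leaf below such a run has nearly the extreme depth (\<open>AE_frequently_depth_ge\<close>,
  \<open>AE_frequently_depth_le\<close>).  As \<open>p \<noteq> 1 / 2\<close>, we have \<open>\<mu> < \<nu>\<close>, so the lower and upper limits
  differ and almost sure convergence fails.
\<close>

section \<open>The depth of a leaf as a number of branchings\<close>

text \<open>Level \<open>j\<close> contributes an inner node to the path of leaf \<open>i\<close> in the PATRICIA trie exactly if
  some string leaves the path there.  All estimates of depths below are about this set.\<close>

definition branch_levels :: "('i \<Rightarrow> bool stream) \<Rightarrow> 'i set \<Rightarrow> 'i \<Rightarrow> nat set" where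
  "branch_levels f I i = {j. \<exists>i'\<in>I. stake j (f i') = stake j (f i) \<and> f i' !! j \<noteq> f i !! j}"

lemma branch_levels_mono: "I \<subseteq> I' \<Longrightarrow> branch_levels f I i \<subseteq> branch_levels f I' i"
  by (auto simp: branch_levels_def)

lemma leaves_compress [simp]: "leaves (compress t) = leaves t"
proof (induction t)
  case (Branch l r)
  have "compress l = Empty \<Longrightarrow> leaves l = {}" "compress r = Empty \<Longrightarrow> leaves r = {}"
    using Branch.IH by (metis leaves.simps(1))+
  with Branch.IH show ?case
    by auto
qed auto

lemma compress_eq_Empty_iff: "compress t = Empty \<longleftrightarrow> leaves t = {}"
  by (induction t) auto

lemma leaf_depth_compress_Branch:
  "leaf_depth (compress (Branch l r)) i =
     (if leaves l = {} then leaf_depth (compress r) i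
      else if leaves r = {} then leaf_depth (compress l) i
      else Suc (if i \<in> leaves l then leaf_depth (compress l) i else leaf_depth (compress r) i))"
  by (simp add: compress_eq_Empty_iff)

text \<open>A string leaves the path of \<open>i\<close> only once, namely at the first bit where the two strings
  differ, so different branching levels have different witnesses.  A witness for a level
  \<open>\<ge> L\<close> agrees with the string of \<open>i\<close> on the first \<open>L\<close> bits.\<close>

lemma branch_level_witnesses:
  "\<exists>g. inj_on g (branch_levels f I i \<inter> {L..}) \<and>
       g ` (branch_levels f I i \<inter> {L..}) \<subseteq> {i' \<in> I - {i}. stake L (f i') = stake L (f i)}"
proof -
  have "\<forall>j\<in>branch_levels f I i. \<exists>i'\<in>I. stake j (f i') = stake j (f i) \<and> f i' !! j \<noteq> f i !! j"
    by (auto simp: branch_levels_def)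
  then obtain g where g: "\<And>j. j \<in> branch_levels f I i \<Longrightarrow>
      g j \<in> I \<and> stake j (f (g j)) = stake j (f i) \<and> f (g j) !! j \<noteq> f i !! j"
    by metis
  have agree: "f (g j) !! l = f i !! l" if "j \<in> branch_levels f I i" "l < j" for j l
    using g[OF that(1)] that(2) by (metis stake_nth)
  have inj: "inj_on g (branch_levels f I i \<inter> {L..})"
  proof (rule inj_onI)
    fix j l assume *: "j \<in> branch_levels f I i \<inter> {L..}" "l \<in> branch_levels f I i \<inter> {L..}"
      and eq: "g j = g l"
    show "j = l"
      using agree[of j l] agree[of l j] g[of j] g[of l] * eq
      by (metis IntD1 linorder_neqE_nat)
  qed
  have "g j \<in> {i' \<in> I - {i}. stake L (f i') = stake L (f i)}"
    if "j \<in> branch_levels f I i" "L \<le> j" for j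
  proof -
    have "stake L (f (g j)) = stake L (f i)"
      using that agree[OF that(1)] by (intro nth_equalityI) (auto simp: stake_nth)
    with g[OF that(1)] show ?thesis
      by auto
  qed
  with inj show ?thesis
    by blast
qed

lemma finite_branch_levels:
  assumes "finite I"
  shows "finite (branch_levels f I i)"
proof -
  obtain g where g: "inj_on g (branch_levels f I i \<inter> {0..})"
    "g ` (branch_levels f I i \<inter> {0..}) \<subseteq> {i' \<in> I - {i}. stake 0 (f i') = stake 0 (f i)}"
    using branch_level_witnesses[of f I i 0] by auto
  have "finite {i' \<in> I - {i}. stake 0 (f i') = stake 0 (f i)}"
    using assms by simp
  from inj_on_finite[OF g this] show ?thesis
    by simp
qed

text \<open>Each branching at a level \<open>\<ge> L\<close> takes a string of its own from those that share the first
  \<open>L\<close> bits.  So a leaf can only be deep if its string shares a long prefix with many others.\<close>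

lemma card_branch_levels_le:
  assumes "finite I"
  shows "card (branch_levels f I i) \<le> L + card {i' \<in> I - {i}. stake L (f i') = stake L (f i)}"
proof -
  obtain g where g: "inj_on g (branch_levels f I i \<inter> {L..})"
    "g ` (branch_levels f I i \<inter> {L..}) \<subseteq> {i' \<in> I - {i}. stake L (f i') = stake L (f i)}"
    using branch_level_witnesses[of f I i L] by auto
  have "finite {i' \<in> I - {i}. stake L (f i') = stake L (f i)}"
    using assms by simp
  from card_inj_on_le[OF g this]
  have "card (branch_levels f I i \<inter> {L..}) \<le> card {i' \<in> I - {i}. stake L (f i') = stake L (f i)}" .
  moreover have "card (branch_levels f I i \<inter> {..<L}) \<le> card {..<L}"
    by (intro card_mono) auto
  moreover have "branch_levels f I i = branch_levels f I i \<inter> {..<L} \<union> branch_levels f I i \<inter> {L..}"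
    by auto
  then have "card (branch_levels f I i) \<le>
      card (branch_levels f I i \<inter> {..<L}) + card (branch_levels f I i \<inter> {L..})"
    by (metis card_Un_le)
  ultimately show ?thesis
    by simp
qed

lemma card_branch_levels_ge:
  assumes "finite I" "{..<k} \<subseteq> branch_levels f I i"
  shows "k \<le> card (branch_levels f I i)"
  using card_mono[OF finite_branch_levels[OF assms(1)] assms(2)] by simp

text \<open>The recursion of the trie, seen from the path of \<open>i\<close>: the root is kept by the compression
  exactly if it has two nonempty subtrees, and the remaining levels are those of the subtree of
  \<open>i\<close>, shifted by one.\<close>

lemma branch_levels_split:
  "branch_levels f I i =
     (if \<exists>i'\<in>I. shd (f i') \<noteq> shd (f i) then {0} else {}) \<union>
     Suc ` branch_levels (\<lambda>i. stl (f i)) {i' \<in> I. shd (f i') = shd (f i)} i"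
  (is "?A = ?B")
proof (rule set_eqI)
  fix j
  show "j \<in> ?A \<longleftrightarrow> j \<in> ?B"
    by (cases j) (auto simp: branch_levels_def image_iff)
qed

lemma leaf_depth_patricia:
  assumes "finite I" "inj_on f I" "i \<in> I"
  shows "leaf_depth (patricia f I) i = card (branch_levels f I i)"
  using assms
proof (induction f I rule: trie.induct)
  case (1 f I)
  show ?case
  proof (cases "card I = 1")
    case True
    then obtain a where "I = {a}"
      by (auto simp: card_1_singleton_iff)
    then show ?thesis
      using 1(5) by (subst patricia_def, subst trie.simps) (simp add: branch_levels_def)
  next
    case False
    with 1(3-5) have I: "\<not> (infinite I \<or> \<not> inj_on f I \<or> I = {})" "card I \<noteq> 1"
      by auto
    let ?g = "\<lambda>j. stl (f j)" and ?J = "\<lambda>b. {j \<in> I. shd (f j) = b}"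
    have fin: "finite {i \<in> I. P i}" for P
      using 1(3) by simp
    have split: "trie f I = Branch (trie ?g {i \<in> I. \<not> shd (f i)}) (trie ?g {i \<in> I. shd (f i)})"
      using I by (intro trie_Branch) blast+
    have lv: "leaves (trie ?g {i \<in> I. \<not> shd (f i)}) = {i \<in> I. \<not> shd (f i)}"
      "leaves (trie ?g {i \<in> I. shd (f i)}) = {i \<in> I. shd (f i)}"
      using 1(4) by (auto simp: leaves_trie fin inj_on_stl)
    have IH: "leaf_depth (compress (trie ?g {i \<in> I. \<not> shd (f i)})) i = card (branch_levels ?g {i \<in> I. \<not> shd (f i)} i)"
      if "\<not> shd (f i)"
      using 1(1)[OF I fin inj_on_stl(2)[OF 1(4)]] 1(5) that by (simp add: patricia_def)
    have IH': "leaf_depth (compress (trie ?g {i \<in> I. shd (f i)})) i = card (branch_levels ?g {i \<in> I. shd (f i)} i)"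
      if "shd (f i)"
      using 1(2)[OF I fin inj_on_stl(1)[OF 1(4)]] 1(5) that by (simp add: patricia_def)
    have *: "leaf_depth (patricia f I) i =
        (if \<exists>i'\<in>I. shd (f i') \<noteq> shd (f i) then 1 else 0) +
        card (branch_levels ?g (?J (shd (f i))) i)"
    proof (cases "shd (f i)")
      case True
      then show ?thesis
        using 1(5) IH' unfolding patricia_def split leaf_depth_compress_Branch lv by auto
    next
      case False
      then show ?thesis
        using 1(5) IH unfolding patricia_def split leaf_depth_compress_Branch lv by auto
    qed
    have "card (branch_levels f I i) =
        (if \<exists>i'\<in>I. shd (f i') \<noteq> shd (f i) then 1 else 0) +
        card (Suc ` branch_levels ?g (?J (shd (f i))) i)"
      by (subst branch_levels_split) (auto simp: finite_branch_levels fin)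
    with * show ?thesis
      by (simp add: card_image)
  qed
qed

text \<open>Along the word \<open>w\<close>, level \<open>j\<close> branches as soon as some string lies below the sibling of the
  node at depth \<open>j + 1\<close>.\<close>

lemma branch_levelI:
  assumes "i' \<in> I" "stake (length w) (f i) = w" "j < length w"
    and "stake (Suc j) (f i') = take j w @ [\<not> w ! j]"
  shows "j \<in> branch_levels f I i"
proof -
  have "stake j (f i') = take j w" "f i' !! j = (\<not> w ! j)"
    using assms(3,4) unfolding stake_Suc by auto
  moreover have "stake j (f i) = take j w" "f i !! j = w ! j"
    using assms(2,3) by (metis take_stake min.strict_order_iff, metis stake_nth)
  ultimately show ?thesis
    using assms(1) by (auto simp: branch_levels_def)
qed

section \<open>Words, cylinders and their probabilities\<close>

definition word_prob :: "real \<Rightarrow> bool list \<Rightarrow> real" where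
  "word_prob p w = (\<Prod>b\<leftarrow>w. if b then p else 1 - p)"

lemma word_prob_simps [simp]:
  "word_prob p [] = 1"
  "word_prob p (b # w) = (if b then p else 1 - p) * word_prob p w"
  "word_prob p (v @ w) = word_prob p v * word_prob p w"
  "word_prob p (replicate k b) = (if b then p else 1 - p) ^ k"
  by (simp_all add: word_prob_def)

lemma words_Suc:
  "{w :: bool list. length w = Suc L} = (#) True ` {w. length w = L} \<union> (#) False ` {w. length w = L}"
  by (auto simp: length_Suc_conv image_iff)

lemma finite_words [simp]: "finite {w :: bool list. length w = L}"
  using finite_lists_length_eq[of "UNIV :: bool set" L] by simp

lemma sum_words_Suc:
  "(\<Sum>w | length w = Suc L. f w) = (\<Sum>w | length w = L. f (True # w) + f (False # w))"
  unfolding words_Suc by (subst sum.union_disjoint) (auto simp: sum.reindex sum.distrib)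

lemma sum_word_prob: "(\<Sum>w | length w = L. word_prob p w) = 1"
  by (induction L) (simp_all add: sum_words_Suc sum_distrib_right[symmetric] sum_distrib_left[symmetric] distrib_right[symmetric])

lemma word_prob_pos: "0 < p \<Longrightarrow> p < 1 \<Longrightarrow> 0 < word_prob p w"
  by (induction w) auto

lemma word_prob_nonneg: "0 < p \<Longrightarrow> p < 1 \<Longrightarrow> 0 \<le> word_prob p w"
  by (rule less_imp_le[OF word_prob_pos])

lemma sum_word_prob_le_1:
  assumes "0 < p" "p < 1" "W \<subseteq> {w. length w = L}"
  shows "(\<Sum>w\<in>W. word_prob p w) \<le> 1"
  using sum_mono2[OF finite_words assms(3), of "word_prob p"] word_prob_nonneg[OF assms(1,2)]
  by (simp add: sum_word_prob)

lemma word_prob_le: "1 / 2 < p \<Longrightarrow> p < 1 \<Longrightarrow> word_prob p w \<le> p ^ length w"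
  by (induction w) (auto intro!: mult_mono word_prob_nonneg)

lemma word_prob_ge: "1 / 2 < p \<Longrightarrow> p < 1 \<Longrightarrow> (1 - p) ^ length w \<le> word_prob p w"
  by (induction w) (auto intro!: mult_mono word_prob_nonneg)

lemma word_prob_le_take:
  assumes "0 < p" "p < 1"
  shows "word_prob p w \<le> word_prob p (take j w)"
proof -
  have le1: "word_prob p v \<le> 1" for v
    using sum_word_prob_le_1[OF assms, of "{v}" "length v"] by simp
  have "word_prob p w = word_prob p (take j w) * word_prob p (drop j w)"
    unfolding word_prob_simps(3)[symmetric] by simp
  with le1[of "drop j w"] show ?thesis
    using mult_left_le[OF le1, of "word_prob p (take j w)" "drop j w"] word_prob_nonneg[OF assms] by simp
qed

definition cylinder :: "bool list \<Rightarrow> bool stream set" where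
  "cylinder w = {x. stake (length w) x = w}"

abbreviation string_measure :: "real \<Rightarrow> bool stream measure" where
  "string_measure p \<equiv> stream_space (measure_pmf (bernoulli_pmf p))"

lemma sets_string_measure: "sets (string_measure p) = sets (stream_space (count_space UNIV))"
  by (rule sets_stream_space_cong) simp

lemma space_string_measure [simp]: "space (string_measure p) = UNIV"
  by (simp add: space_stream_space)

lemma cylinder_measurable: "cylinder w \<in> sets (stream_space (count_space UNIV))"
proof -
  have "cylinder w = stake (length w) -` {w} \<inter> space (stream_space (count_space UNIV))"
    by (auto simp: cylinder_def space_stream_space)
  also have "\<dots> \<in> sets (stream_space (count_space UNIV))"
    by (rule measurable_sets[OF measurable_stake]) simp
  finally show ?thesis .
qed

lemma prob_space_string_measure: "prob_space (string_measure p)"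
  by (intro prob_space.prob_space_stream_space measure_pmf.prob_space_axioms)

lemma measure_cylinder:
  assumes "0 < p" "p < 1"
  shows "measure (string_measure p) (cylinder w) = word_prob p w"
proof (induction w)
  case Nil
  have "cylinder [] = space (string_measure p)"
    by (simp add: cylinder_def)
  then show ?case
    using prob_space.prob_space[OF prob_space_string_measure] by simp
next
  case (Cons b w)
  interpret sp: prob_space "string_measure p"
    by (rule prob_space_string_measure)
  have "emeasure (string_measure p) (cylinder (b # w)) =
      (\<integral>\<^sup>+t. emeasure (string_measure p) {x. t ## x \<in> cylinder (b # w)} \<partial>bernoulli_pmf p)"
    by (subst prob_space.emeasure_stream_space[OF measure_pmf.prob_space_axioms])
       (simp_all add: cylinder_measurable sets_string_measure)
  also have "(\<lambda>t. {x. t ## x \<in> cylinder (b # w)}) = (\<lambda>t. if t = b then cylinder w else {})"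
    by (auto simp: cylinder_def fun_eq_iff)
  also have "(\<integral>\<^sup>+t. emeasure (string_measure p) (if t = b then cylinder w else {}) \<partial>bernoulli_pmf p) =
      ennreal (word_prob p (b # w))"
    using assms Cons.IH word_prob_nonneg[OF assms, of w]
    by (cases b) (simp_all add: sp.emeasure_eq_measure ennreal_mult' mult.commute)
  finally show ?case
    using word_prob_nonneg[OF assms, of "b # w"] by (simp add: sp.emeasure_eq_measure)
qed

lemma measure_not_cylinder:
  assumes "0 < p" "p < 1"
  shows "measure (string_measure p) (- cylinder w) = 1 - word_prob p w"
proof -
  interpret sp: prob_space "string_measure p"
    by (rule prob_space_string_measure)
  show ?thesis
    using sp.prob_compl[of "cylinder w"] cylinder_measurable[of w]
    by (simp add: measure_cylinder assms sets_string_measure Compl_eq_Diff_UNIV)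
qed

section \<open>Outer bounds for probabilities\<close>

context prob_space
begin

text \<open>An outer probability bound.  It lets the estimates below work with arbitrary predicates and
  discard null sets, so that exceptional sets need not be shown to be measurable.\<close>

definition outer_le :: "('a \<Rightarrow> bool) \<Rightarrow> real \<Rightarrow> bool" where
  "outer_le P b \<longleftrightarrow> (\<exists>E\<in>events. prob E \<le> b \<and> (AE \<omega> in M. P \<omega> \<longrightarrow> \<omega> \<in> E))"

lemma outer_leI:
  assumes "{\<omega> \<in> space M. P \<omega>} \<in> events" "prob {\<omega> \<in> space M. P \<omega>} \<le> b"
  shows "outer_le P b"
  unfolding outer_le_def using assms by (intro bexI[of _ "{\<omega> \<in> space M. P \<omega>}"]) (auto intro: AE_I2)

lemma outer_le_mono:
  assumes "outer_le P a" "a \<le> b" "AE \<omega> in M. Q \<omega> \<longrightarrow> P \<omega>"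
  shows "outer_le Q b"
proof -
  obtain E where E: "E \<in> events" "prob E \<le> a" "AE \<omega> in M. P \<omega> \<longrightarrow> \<omega> \<in> E"
    using assms(1) by (auto simp: outer_le_def)
  have "AE \<omega> in M. Q \<omega> \<longrightarrow> \<omega> \<in> E"
    using E(3) assms(3) by eventually_elim simp
  with E assms(2) show ?thesis
    unfolding outer_le_def by (intro bexI[of _ E]) auto
qed

lemma outer_le_Bex:
  assumes "finite I" "\<And>i. i \<in> I \<Longrightarrow> outer_le (P i) (b i)"
  shows "outer_le (\<lambda>\<omega>. \<exists>i\<in>I. P i \<omega>) (\<Sum>i\<in>I. b i)"
proof -
  have "\<forall>i\<in>I. \<exists>E. E \<in> events \<and> prob E \<le> b i \<and> (AE \<omega> in M. P i \<omega> \<longrightarrow> \<omega> \<in> E)"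
    using assms(2) by (auto simp: outer_le_def)
  then obtain E where E: "\<And>i. i \<in> I \<Longrightarrow> E i \<in> events" "\<And>i. i \<in> I \<Longrightarrow> prob (E i) \<le> b i"
      "\<And>i. i \<in> I \<Longrightarrow> AE \<omega> in M. P i \<omega> \<longrightarrow> \<omega> \<in> E i"
    by metis
  have "prob (\<Union>i\<in>I. E i) \<le> (\<Sum>i\<in>I. prob (E i))"
    using assms(1) E(1) by (intro finite_measure_subadditive_finite) auto
  also have "\<dots> \<le> (\<Sum>i\<in>I. b i)"
    by (rule sum_mono) (rule E(2))
  finally have "prob (\<Union>i\<in>I. E i) \<le> (\<Sum>i\<in>I. b i)" .
  moreover have "AE \<omega> in M. (\<exists>i\<in>I. P i \<omega>) \<longrightarrow> \<omega> \<in> (\<Union>i\<in>I. E i)"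
  proof -
    have "AE \<omega> in M. \<forall>i\<in>I. P i \<omega> \<longrightarrow> \<omega> \<in> E i"
      using assms(1) E(3) by (intro AE_finite_allI)
    then show ?thesis
      by eventually_elim auto
  qed
  moreover have "(\<Union>i\<in>I. E i) \<in> events"
    using assms(1) E(1) by (intro sets.finite_UN) auto
  ultimately show ?thesis
    unfolding outer_le_def by blast
qed

lemma outer_le_disj:
  assumes "outer_le P a" "outer_le Q b"
  shows "outer_le (\<lambda>\<omega>. P \<omega> \<or> Q \<omega>) (a + b)"
proof -
  have "outer_le (\<lambda>\<omega>. \<exists>i\<in>{True, False}. (if i then P \<omega> else Q \<omega>)) (\<Sum>i\<in>{True, False}. if i then a else b)"
    using assms by (intro outer_le_Bex) auto
  then show ?thesis
    by (rule outer_le_mono) auto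
qed

lemma prob_le_of_outer_le:
  assumes "outer_le P b" "{\<omega> \<in> space M. P \<omega>} \<in> events"
  shows "prob {\<omega> \<in> space M. P \<omega>} \<le> b"
proof -
  obtain E where E: "E \<in> events" "prob E \<le> b" "AE \<omega> in M. P \<omega> \<longrightarrow> \<omega> \<in> E"
    using assms(1) by (auto simp: outer_le_def)
  have "prob {\<omega> \<in> space M. P \<omega>} \<le> prob E"
    using E(1,3) by (intro finite_measure_mono_AE) auto
  with E(2) show ?thesis
    by simp
qed

text \<open>A predicate that is covered by events of arbitrarily small probability fails almost surely.
  This replaces the second Borel--Cantelli lemma: to see that something happens infinitely often,
  it is enough to bound, for every \<open>N0\<close>, the probability that it fails throughout a late block of
  indices.\<close>

lemma AE_not_of_outer_le_tendsto:
  assumes "\<forall>\<^sub>F N in sequentially. outer_le P (b N)" "b \<longlonglongrightarrow> 0"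
  shows "AE \<omega> in M. \<not> P \<omega>"
proof -
  obtain N0 where N0: "\<And>N. N \<ge> N0 \<Longrightarrow> outer_le P (b N)"
    using assms(1) by (auto simp: eventually_sequentially)
  then have "\<forall>N. \<exists>E. E \<in> events \<and> prob E \<le> b (N + N0) \<and> (AE \<omega> in M. P \<omega> \<longrightarrow> \<omega> \<in> E)"
    unfolding outer_le_def by (meson le_add2)
  then obtain E where E: "\<And>N. E N \<in> events" "\<And>N. prob (E N) \<le> b (N + N0)"
      "\<And>N. AE \<omega> in M. P \<omega> \<longrightarrow> \<omega> \<in> E N"
    by metis
  have "prob (\<Inter>N. E N) \<le> b (N + N0)" for N
    using finite_measure_mono[of "\<Inter>N. E N" "E N"] E(1,2)[of N] by force
  moreover have "(\<lambda>N. b (N + N0)) \<longlonglongrightarrow> 0"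
    using assms(2) by (rule LIMSEQ_ignore_initial_segment)
  ultimately have "prob (\<Inter>N. E N) \<le> 0"
    by (intro LIMSEQ_le_const) auto
  then have "prob (\<Inter>N. E N) = 0"
    by (simp add: measure_le_0_iff)
  moreover have "(\<Inter>N. E N) \<in> events"
    using E(1) by auto
  ultimately have "AE \<omega> in M. \<omega> \<notin> (\<Inter>N. E N)"
    by (simp add: prob_eq_0)
  moreover have "AE \<omega> in M. \<forall>N. P \<omega> \<longrightarrow> \<omega> \<in> E N"
    using E(3) by (subst AE_all_countable) blast
  ultimately show ?thesis
    by eventually_elim auto
qed

text \<open>The first Borel--Cantelli lemma for outer bounds.\<close>

lemma AE_eventually_not_of_summable:
  assumes "\<forall>\<^sub>F n in sequentially. outer_le (P n) (b n)" "summable b"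
  shows "AE \<omega> in M. \<forall>\<^sub>F n in sequentially. \<not> P n \<omega>"
proof -
  obtain N0 where N0: "\<And>n. n \<ge> N0 \<Longrightarrow> outer_le (P n) (b n)"
    using assms(1) by (auto simp: eventually_sequentially)
  then have "\<forall>n. \<exists>E. E \<in> events \<and> prob E \<le> b (n + N0) \<and> (AE \<omega> in M. P (n + N0) \<omega> \<longrightarrow> \<omega> \<in> E)"
    unfolding outer_le_def by (meson le_add2)
  then obtain E where E: "\<And>n. E n \<in> events" "\<And>n. prob (E n) \<le> b (n + N0)"
      "\<And>n. AE \<omega> in M. P (n + N0) \<omega> \<longrightarrow> \<omega> \<in> E n"
    by metis
  have "summable (\<lambda>n. b (n + N0))"
    using assms(2) by (rule summable_ignore_initial_segment)
  then have "summable (\<lambda>n. prob (E n))"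
    by (rule summable_comparison_test[rotated]) (use E(2) in auto)
  then have "AE \<omega> in M. \<forall>\<^sub>F n in sequentially. \<omega> \<in> space M - E n"
    using E(1) by (intro borel_cantelli_AE1) (auto simp: emeasure_eq_measure)
  moreover have "AE \<omega> in M. \<forall>n. P (n + N0) \<omega> \<longrightarrow> \<omega> \<in> E n"
    using E(3) by (subst AE_all_countable) blast
  ultimately show ?thesis
  proof eventually_elim
    case (elim \<omega>)
    then have "\<forall>\<^sub>F n in sequentially. \<not> P (n + N0) \<omega>"
      by (auto elim: eventually_mono)
    then show ?case
      using eventually_sequentially_seg[of "\<lambda>n. \<not> P n \<omega>" N0] by simp
  qed
qed

end

section \<open>Joint law of the strings and of the chosen leaves\<close>

locale biased_patricia = random_patricia +
  assumes half_less_p: "1 / 2 < p" and p_less_1: "p < 1"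
begin

lemma p_pos: "0 < p"
  using half_less_p by simp

lemmas wp_nonneg = word_prob_nonneg[OF p_pos p_less_1]
lemmas wp_pos = word_prob_pos[OF p_pos p_less_1]

text \<open>All probabilities below reduce to this product formula: finitely many strings and finitely
  many chosen indices are independent, and \<open>U n\<close> is uniform on \<open>{1..n}\<close>.\<close>

lemma
  assumes J: "finite J" "J \<subseteq> {1..}" and K: "finite K" "K \<subseteq> {1..}"
    and A: "\<And>j. j \<in> J \<Longrightarrow> A j \<in> sets (stream_space (count_space UNIV))"
  shows SU_event: "{\<omega> \<in> space M. (\<forall>j\<in>J. S j \<omega> \<in> A j) \<and> (\<forall>n\<in>K. U n \<omega> \<in> C n)} \<in> events" (is "?E \<in> _")
    and prob_SU: "prob {\<omega> \<in> space M. (\<forall>j\<in>J. S j \<omega> \<in> A j) \<and> (\<forall>n\<in>K. U n \<omega> \<in> C n)} =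
      (\<Prod>j\<in>J. measure (string_measure p) (A j)) * (\<Prod>n\<in>K. real (card (C n \<inter> {1..n})) / real n)"
proof -
  define X where "X = case_sum (\<lambda>j. S j -` A j \<inter> space M) (\<lambda>n. U n -` C n \<inter> space M)"
  have S_ev: "S j -` A j \<inter> space M \<in> events" if "j \<in> J" for j
    using that J(2) A[OF that] S_measurable[of j] by (auto intro: measurable_sets)
  have U_ev: "U n -` C n \<inter> space M \<in> events" if "n \<in> K" for n
    using that K(2) U_measurable[of n] by (auto intro: measurable_sets)
  have E_eq: "?E = (\<Inter>x\<in>J <+> K. X x) \<inter> space M"
  proof (rule set_eqI)
    fix \<omega>
    show "\<omega> \<in> ?E \<longleftrightarrow> \<omega> \<in> (\<Inter>x\<in>J <+> K. X x) \<inter> space M"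
      unfolding Plus_def INT_Un image_image INT_iff X_def by auto
  qed
  have X_ev: "X x \<in> events" if "x \<in> J <+> K" for x
    using that S_ev U_ev by (auto simp: X_def)
  show "?E \<in> events"
  proof (cases "J <+> K = {}")
    case False
    then have "(\<Inter>x\<in>J <+> K. X x) \<in> events"
      using J(1) K(1) X_ev by (intro sets.finite_INT) auto
    then show ?thesis
      unfolding E_eq by auto
  qed (simp add: E_eq)
  have "prob ?E = (\<Prod>x\<in>J <+> K. prob (X x))"
  proof (cases "J <+> K = {}")
    case True
    then show ?thesis
      unfolding E_eq True by (simp add: prob_space)
  next
    case False
    have "(\<Inter>x\<in>J <+> K. X x) \<subseteq> space M"
      using False by (auto simp: X_def split: sum.splits)
    then have "prob ?E = prob (\<Inter>x\<in>J <+> K. X x)"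
      unfolding E_eq by (simp add: Int_absorb2)
    also have "\<dots> = (\<Prod>x\<in>J <+> K. prob (X x))"
    proof (rule indep_setsD[OF indep])
      show "\<forall>x\<in>J <+> K. X x \<in> (case x of
          Inl i \<Rightarrow> {S i -` A \<inter> space M | A. A \<in> sets (stream_space (count_space UNIV))}
        | Inr n \<Rightarrow> {U n -` A \<inter> space M | A. A \<in> sets (count_space UNIV)})"
      proof
        fix x assume "x \<in> J <+> K"
        then show "X x \<in> (case x of
            Inl i \<Rightarrow> {S i -` A \<inter> space M | A. A \<in> sets (stream_space (count_space UNIV))}
          | Inr n \<Rightarrow> {U n -` A \<inter> space M | A. A \<in> sets (count_space UNIV)})"
          using A by (cases x) (force simp: X_def)+
      qed
    qed (use False J K in auto)
    finally show ?thesis .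
  qed
  also have "\<dots> = (\<Prod>j\<in>J. prob (X (Inl j))) * (\<Prod>n\<in>K. prob (X (Inr n)))"
    using J(1) K(1) by (simp add: prod.Plus)
  also have "(\<Prod>j\<in>J. prob (X (Inl j))) = (\<Prod>j\<in>J. measure (string_measure p) (A j))"
  proof (rule prod.cong)
    fix j assume j: "j \<in> J"
    then have "1 \<le> j"
      using J(2) by auto
    have "prob (X (Inl j)) = measure (distr M (stream_space (count_space UNIV)) (S j)) (A j)"
      using measure_distr[OF S_measurable[OF \<open>1 \<le> j\<close>] A[OF j]] by (simp add: X_def)
    then show "prob (X (Inl j)) = measure (string_measure p) (A j)"
      by (simp only: S_distr[OF \<open>1 \<le> j\<close>])
  qed simp
  also have "(\<Prod>n\<in>K. prob (X (Inr n))) = (\<Prod>n\<in>K. real (card (C n \<inter> {1..n})) / real n)"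
  proof (rule prod.cong)
    fix n assume n: "n \<in> K"
    then have "1 \<le> n"
      using K(2) by auto
    have "prob (X (Inr n)) = measure (distr M (count_space UNIV) (U n)) (C n)"
      using measure_distr[OF U_measurable[OF \<open>1 \<le> n\<close>], of "C n"] by (simp add: X_def)
    also have "\<dots> = measure (measure_pmf (pmf_of_set {1..n})) (C n)"
      by (simp only: U_distr[OF \<open>1 \<le> n\<close>])
    also have "\<dots> = real (card (C n \<inter> {1..n})) / real n"
      using \<open>1 \<le> n\<close> by (subst measure_pmf_of_set) (auto simp: Int_commute)
    finally show "prob (X (Inr n)) = real (card (C n \<inter> {1..n})) / real n" .
  qed simp
  finally show "prob ?E = (\<Prod>j\<in>J. measure (string_measure p) (A j)) *
      (\<Prod>n\<in>K. real (card (C n \<inter> {1..n})) / real n)" .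
qed

lemma outer_le_SU:
  assumes "finite J" "J \<subseteq> {1..}" "finite K" "K \<subseteq> {1..}"
    and "\<And>j. j \<in> J \<Longrightarrow> A j \<in> sets (stream_space (count_space UNIV))"
    and "(\<Prod>j\<in>J. measure (string_measure p) (A j)) * (\<Prod>n\<in>K. real (card (C n \<inter> {1..n})) / real n) \<le> b"
  shows "outer_le (\<lambda>\<omega>. (\<forall>j\<in>J. S j \<omega> \<in> A j) \<and> (\<forall>n\<in>K. U n \<omega> \<in> C n)) b"
  using assms by (intro outer_leI) (simp_all add: SU_event prob_SU)

text \<open>If at least \<open>m\<close> other strings share the first \<open>L\<close> bits of string \<open>i\<close>, there are a word
  \<open>w\<close> and a set of \<open>m\<close> indices such that these strings and string \<open>i\<close> all start with \<open>w\<close>.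
  There are at most \<open>n ^ m\<close> such sets, each of which has probability
  \<open>word_prob p w ^ Suc m\<close>.  Having a whole crowd of size \<open>m\<close> instead of a single companion is
  what makes the bound summable over \<open>n\<close> later on.\<close>

lemma outer_le_crowd:
  assumes i: "i \<in> {1..n}" and W: "W \<subseteq> {w. length w = L}"
  shows "outer_le (\<lambda>\<omega>. U n \<omega> \<in> C \<and> stake L (S i \<omega>) \<in> W \<and>
            m \<le> card {j \<in> {1..n} - {i}. stake L (S j \<omega>) = stake L (S i \<omega>)})
           (real (card (C \<inter> {1..n})) / real n * (\<Sum>w\<in>W. word_prob p w * (real n * word_prob p w) ^ m))"
proof -
  let ?c = "real (card (C \<inter> {1..n})) / real n"
  let ?T = "{T. T \<subseteq> {1..n} - {i} \<and> card T = m}"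
  let ?Q = "\<lambda>w T \<omega>. (\<forall>j\<in>insert i T. S j \<omega> \<in> cylinder w) \<and> (\<forall>n'\<in>{n}. U n' \<omega> \<in> C)"
  have fin: "finite W" "finite ?T"
    using W finite_subset[OF W finite_words] by auto
  have card_T: "real (card ?T) \<le> real n ^ m"
  proof -
    have "card ?T = (n - 1) choose m"
      using i n_subsets[of "{1..n} - {i}" m] by simp
    also have "\<dots> \<le> n ^ m"
    proof (cases "m \<le> n - 1")
      case True
      then have "(n - 1) choose m \<le> (n - 1) ^ m"
        by (rule binomial_le_pow)
      also have "\<dots> \<le> n ^ m"
        by (simp add: power_mono)
      finally show ?thesis .
    qed (simp add: binomial_eq_0)
    finally show ?thesis
      by (simp only: of_nat_power[symmetric] of_nat_le_iff)
  qed
  have Q: "outer_le (?Q w T) (?c * word_prob p w ^ Suc m)" if "w \<in> W" "T \<in> ?T" for w T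
  proof (rule outer_le_SU)
    have "finite T"
      using that(2) finite_subset[of T "{1..n} - {i}"] by auto
    moreover have "i \<notin> T" "card T = m"
      using that(2) by auto
    ultimately show "(\<Prod>j\<in>insert i T. measure (string_measure p) (cylinder w)) *
        (\<Prod>n\<in>{n}. real (card (C \<inter> {1..n})) / real n) \<le> ?c * word_prob p w ^ Suc m"
      by (simp add: measure_cylinder p_pos p_less_1 mult_ac)
    show "finite (insert i T)"
      using \<open>finite T\<close> by simp
    show "insert i T \<subseteq> {1..}" "{n} \<subseteq> {1..}"
      using that(2) i by auto
  qed (simp_all add: cylinder_measurable)
  have "outer_le (\<lambda>\<omega>. \<exists>w\<in>W. \<exists>T\<in>?T. ?Q w T \<omega>) (\<Sum>w\<in>W. \<Sum>T\<in>?T. ?c * word_prob p w ^ Suc m)"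
    by (intro outer_le_Bex fin Q)
  then show ?thesis
  proof (rule outer_le_mono)
    have "(\<Sum>T\<in>?T. ?c * word_prob p w ^ Suc m) \<le> ?c * (word_prob p w * (real n * word_prob p w) ^ m)" for w
    proof -
      have "(\<Sum>T\<in>?T. ?c * word_prob p w ^ Suc m) = real (card ?T) * (?c * word_prob p w ^ Suc m)"
        by simp
      also have "\<dots> \<le> real n ^ m * (?c * word_prob p w ^ Suc m)"
        using card_T wp_nonneg by (intro mult_right_mono) auto
      also have "\<dots> = ?c * (word_prob p w * (real n * word_prob p w) ^ m)"
        by (simp add: power_mult_distrib)
      finally show ?thesis .
    qed
    then show "(\<Sum>w\<in>W. \<Sum>T\<in>?T. ?c * word_prob p w ^ Suc m) \<le>
        ?c * (\<Sum>w\<in>W. word_prob p w * (real n * word_prob p w) ^ m)"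
      unfolding sum_distrib_left by (intro sum_mono) simp
    show "AE \<omega> in M. U n \<omega> \<in> C \<and> stake L (S i \<omega>) \<in> W \<and>
        m \<le> card {j \<in> {1..n} - {i}. stake L (S j \<omega>) = stake L (S i \<omega>)} \<longrightarrow>
        (\<exists>w\<in>W. \<exists>T\<in>?T. ?Q w T \<omega>)"
    proof (intro AE_I2 impI)
      fix \<omega>
      assume *: "U n \<omega> \<in> C \<and> stake L (S i \<omega>) \<in> W \<and>
        m \<le> card {j \<in> {1..n} - {i}. stake L (S j \<omega>) = stake L (S i \<omega>)}"
      then obtain T where T: "T \<subseteq> {j \<in> {1..n} - {i}. stake L (S j \<omega>) = stake L (S i \<omega>)}" "card T = m"
        by (meson obtain_subset_with_card_n)
      have "length (stake L (S i \<omega>)) = L"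
        by simp
      with T * show "\<exists>w\<in>W. \<exists>T\<in>?T. ?Q w T \<omega>"
        by (intro bexI[of _ "stake L (S i \<omega>)"] bexI[of _ T]) (auto simp: cylinder_def)
    qed
  qed
qed

text \<open>If level \<open>j < k\<close> does not branch on the path \<open>w\<close> of string \<open>i\<close>, none of the other
  \<open>n - 1\<close> strings lies below the sibling of the node at depth \<open>j + 1\<close>.  That sibling has
  probability at least \<open>(1 - p) * word_prob p w\<close>, because \<open>1 - p\<close> is the smaller of the two bit
  probabilities.\<close>

lemma outer_le_gap:
  assumes i: "i \<in> {1..n}" and W: "W \<subseteq> {w. length w = k}"
  shows "outer_le (\<lambda>\<omega>. U n \<omega> \<in> C \<and> stake k (S i \<omega>) \<in> W \<and>
            \<not> {..<k} \<subseteq> branch_levels (\<lambda>j. S j \<omega>) {1..n} i)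
           (real (card (C \<inter> {1..n})) / real n *
             (\<Sum>w\<in>W. word_prob p w * (real k * exp (- (real (n - 1) * ((1 - p) * word_prob p w))))))"
proof -
  let ?c = "real (card (C \<inter> {1..n})) / real n"
  let ?e = "\<lambda>w. exp (- (real (n - 1) * ((1 - p) * word_prob p w)))"
  let ?sib = "\<lambda>w j. take j w @ [\<not> w ! j]"
  let ?Q = "\<lambda>w j \<omega>. (\<forall>i'\<in>{1..n}. S i' \<omega> \<in> (if i' = i then cylinder w else - cylinder (?sib w j)))
      \<and> (\<forall>n'\<in>{n}. U n' \<omega> \<in> C)"
  have fin: "finite W"
    using finite_subset[OF W finite_words] by auto
  have "outer_le (?Q w j) (?c * (word_prob p w * ?e w))" if "w \<in> W" "j < k" for w j
  proof (rule outer_le_SU)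
    let ?x = "word_prob p (?sib w j)"
    have "(1 - p) * word_prob p w \<le> (1 - p) * word_prob p (take j w)"
      using word_prob_le_take[OF p_pos p_less_1] p_less_1 by (intro mult_left_mono) auto
    also have "\<dots> \<le> ?x"
      using half_less_p by (auto intro!: mult_right_mono wp_nonneg simp: mult.commute)
    finally have x: "(1 - p) * word_prob p w \<le> ?x" .
    have x1: "?x \<le> 1"
      using sum_word_prob_le_1[OF p_pos p_less_1, of "{?sib w j}" "length (?sib w j)"] by simp
    have "(1 - ?x) ^ (n - 1) \<le> exp (- ?x) ^ (n - 1)"
      using x1 exp_ge_add_one_self[of "- ?x"] by (intro power_mono) auto
    also have "\<dots> = exp (- (real (n - 1) * ?x))"
      by (simp add: exp_of_nat_mult[symmetric])
    also have "\<dots> \<le> ?e w"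
      using x by (simp add: mult_left_mono)
    finally have le: "(1 - ?x) ^ (n - 1) \<le> ?e w" .
    have "(\<Prod>i'\<in>{1..n}. measure (string_measure p) (if i' = i then cylinder w else - cylinder (?sib w j))) =
        word_prob p w * (\<Prod>i'\<in>{1..n} - {i}. measure (string_measure p) (- cylinder (?sib w j)))"
      using i by (subst prod.remove[of _ i]) (auto simp: measure_cylinder p_pos p_less_1 intro!: prod.cong)
    also have "(\<Prod>i'\<in>{1..n} - {i}. measure (string_measure p) (- cylinder (?sib w j))) = (1 - ?x) ^ (n - 1)"
      using i by (simp add: measure_not_cylinder p_pos p_less_1 del: word_prob_simps)
    finally show "(\<Prod>i'\<in>{1..n}. measure (string_measure p) (if i' = i then cylinder w else - cylinder (?sib w j))) *
        (\<Prod>n\<in>{n}. real (card (C \<inter> {1..n})) / real n) \<le> ?c * (word_prob p w * ?e w)"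
      using le wp_nonneg[of w] mult_left_mono[OF le, of "?c * word_prob p w"] by (simp add: mult_ac)
    show "{n} \<subseteq> {1..}"
      using i by auto
    show "(if i' = i then cylinder w else - cylinder (?sib w j)) \<in> sets (stream_space (count_space UNIV))" for i'
      using sets.compl_sets[OF cylinder_measurable] cylinder_measurable
      by (simp add: Compl_eq_Diff_UNIV space_stream_space)
  qed auto
  then have "outer_le (\<lambda>\<omega>. \<exists>w\<in>W. \<exists>j\<in>{..<k}. ?Q w j \<omega>) (\<Sum>w\<in>W. \<Sum>j\<in>{..<k}. ?c * (word_prob p w * ?e w))"
    using fin by (intro outer_le_Bex) auto
  then show ?thesis
  proof (rule outer_le_mono)
    show "(\<Sum>w\<in>W. \<Sum>j\<in>{..<k}. ?c * (word_prob p w * ?e w)) \<le> ?c * (\<Sum>w\<in>W. word_prob p w * (real k * ?e w))"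
      by (simp add: sum_distrib_left mult_ac)
    show "AE \<omega> in M. U n \<omega> \<in> C \<and> stake k (S i \<omega>) \<in> W \<and>
            \<not> {..<k} \<subseteq> branch_levels (\<lambda>j. S j \<omega>) {1..n} i \<longrightarrow> (\<exists>w\<in>W. \<exists>j\<in>{..<k}. ?Q w j \<omega>)"
    proof (intro AE_I2 impI)
      fix \<omega>
      assume *: "U n \<omega> \<in> C \<and> stake k (S i \<omega>) \<in> W \<and>
            \<not> {..<k} \<subseteq> branch_levels (\<lambda>j. S j \<omega>) {1..n} i"
      then obtain j where j: "j < k" "j \<notin> branch_levels (\<lambda>j. S j \<omega>) {1..n} i"
        by auto
      have len: "length (stake k (S i \<omega>)) = k"
        by simp
      have "S i' \<omega> \<notin> cylinder (?sib (stake k (S i \<omega>)) j)" if "i' \<in> {1..n}" for i'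
        using branch_levelI[of i' "{1..n}" "stake k (S i \<omega>)" "\<lambda>j. S j \<omega>" i j] that j len
        by (auto simp: cylinder_def min_def)
      with * j len show "\<exists>w\<in>W. \<exists>j\<in>{..<k}. ?Q w j \<omega>"
        by (intro bexI[of _ "stake k (S i \<omega>)"] bexI[of _ j]) (auto simp: cylinder_def)
    qed
  qed
qed

text \<open>Given the set \<open>b\<close> of those among the first \<open>N\<close> strings that start with \<open>w\<close>, the choices
  in the block \<open>N \<le> n < 2 * N\<close> are independent, and each misses \<open>b\<close> with probability at most
  \<open>1 - card b / (2 * N) \<le> exp (- card b / (2 * N))\<close>; the \<open>N\<close> choices together give
  \<open>exp (- card b / 2)\<close>.  The size of \<open>b\<close> is binomial, and averaging over \<open>b\<close> is the
  binomial theorem.  This is where the independence of the choices for different \<open>n\<close> enters.\<close>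

lemma outer_le_no_hit:
  assumes "N \<ge> 1"
  shows "outer_le (\<lambda>\<omega>. \<forall>n\<in>{N..<2 * N}. \<not> (U n \<omega> \<in> {1..N} \<and> S (U n \<omega>) \<omega> \<in> cylinder w))
           (exp (- ((1 - exp (- 1 / 2)) * real N * word_prob p w)))"
proof -
  define x where "x = word_prob p w"
  define r :: real where "r = exp (- 1 / 2)"
  let ?A = "\<lambda>b j. if j \<in> b then cylinder w else - cylinder w"
  let ?Q = "\<lambda>b \<omega>. (\<forall>j\<in>{1..N}. S j \<omega> \<in> ?A b j) \<and> (\<forall>n\<in>{N..<2 * N}. U n \<omega> \<in> - b)"
  have x: "0 \<le> x" "x \<le> 1"
    using wp_nonneg[of w] sum_word_prob_le_1[OF p_pos p_less_1, of "{w}" "length w"] by (auto simp: x_def)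
  have "outer_le (?Q b) ((\<Prod>j\<in>b. x * r) * (\<Prod>j\<in>{1..N} - b. 1 - x))" if b: "b \<in> Pow {1..N}" for b
  proof (rule outer_le_SU)
    have fin: "finite b"
      using b by (meson PowD finite_atLeastAtMost finite_subset)
    have "(\<Prod>j\<in>{1..N}. measure (string_measure p) (?A b j)) =
        (\<Prod>j\<in>{1..N} - b. measure (string_measure p) (?A b j)) * (\<Prod>j\<in>b. measure (string_measure p) (?A b j))"
      using b by (intro prod.subset_diff) auto
    also have "\<dots> = (\<Prod>j\<in>{1..N} - b. 1 - x) * (\<Prod>j\<in>b. x)"
      by (intro arg_cong2[where f = "(*)"] prod.cong)
         (auto simp: measure_cylinder measure_not_cylinder p_pos p_less_1 x_def)
    finally have 1: "(\<Prod>j\<in>{1..N}. measure (string_measure p) (?A b j)) =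
        (\<Prod>j\<in>{1..N} - b. 1 - x) * x ^ card b"
      by simp
    have "(\<Prod>n\<in>{N..<2 * N}. real (card (- b \<inter> {1..n})) / real n) \<le>
        (\<Prod>n\<in>{N..<2 * N}. exp (- real (card b) / (2 * real N)))"
    proof (rule prod_mono, intro conjI)
      fix n assume n: "n \<in> {N..<2 * N}"
      have "- b \<inter> {1..n} = {1..n} - b"
        by auto
      moreover have sub: "b \<subseteq> {1..n}"
        using b n by auto
      ultimately have "real (card (- b \<inter> {1..n})) = real n - real (card b)"
        using card_mono[OF _ sub] by (simp add: card_Diff_subset fin of_nat_diff)
      then have "real (card (- b \<inter> {1..n})) / real n = 1 + (- real (card b) / real n)"
        using n assms by (simp add: field_simps)
      also have "\<dots> \<le> exp (- real (card b) / real n)"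
        by (rule exp_ge_add_one_self)
      also have "\<dots> \<le> exp (- real (card b) / (2 * real N))"
      proof -
        have "real (card b) / (2 * real N) \<le> real (card b) / real n"
          using n assms by (intro divide_left_mono) auto
        then show ?thesis
          by simp
      qed
      finally show "real (card (- b \<inter> {1..n})) / real n \<le> exp (- real (card b) / (2 * real N))" .
    qed simp
    also have "\<dots> = exp (- real (card b) / (2 * real N)) ^ N"
      by simp
    also have "\<dots> = exp (- real (card b) / 2)"
      using assms by (simp add: exp_of_nat_mult[symmetric])
    also have "\<dots> = r ^ card b"
      by (simp add: r_def exp_of_nat_mult[symmetric])
    finally have 2: "(\<Prod>n\<in>{N..<2 * N}. real (card (- b \<inter> {1..n})) / real n) \<le> r ^ card b" .
    show "(\<Prod>j\<in>{1..N}. measure (string_measure p) (?A b j)) *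
        (\<Prod>n\<in>{N..<2 * N}. real (card (- b \<inter> {1..n})) / real n) \<le>
        (\<Prod>j\<in>b. x * r) * (\<Prod>j\<in>{1..N} - b. 1 - x)"
      unfolding 1 using mult_left_mono[OF 2, of "(\<Prod>j\<in>{1..N} - b. 1 - x) * x ^ card b"] x
      by (simp add: power_mult_distrib mult_ac)
    show "?A b j \<in> sets (stream_space (count_space UNIV))" for j
      using sets.compl_sets[OF cylinder_measurable] cylinder_measurable
      by (simp add: Compl_eq_Diff_UNIV space_stream_space)
    show "{N..<2 * N} \<subseteq> {1..}"
      using assms by auto
  qed auto
  then have "outer_le (\<lambda>\<omega>. \<exists>b\<in>Pow {1..N}. ?Q b \<omega>)
      (\<Sum>b\<in>Pow {1..N}. (\<Prod>j\<in>b. x * r) * (\<Prod>j\<in>{1..N} - b. 1 - x))"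
    by (intro outer_le_Bex) auto
  then show ?thesis
  proof (rule outer_le_mono)
    have "(\<Sum>b\<in>Pow {1..N}. (\<Prod>j\<in>b. x * r) * (\<Prod>j\<in>{1..N} - b. 1 - x)) = (x * r + (1 - x)) ^ N"
      using prod_add[of "{1..N}" "\<lambda>_. x * r" "\<lambda>_. 1 - x"] by simp
    also have "\<dots> \<le> exp (- ((1 - r) * x)) ^ N"
    proof (rule power_mono)
      show "x * r + (1 - x) \<le> exp (- ((1 - r) * x))"
        using exp_ge_add_one_self[of "- ((1 - r) * x)"] by (simp add: algebra_simps)
      show "0 \<le> x * r + (1 - x)"
        using x by (intro add_nonneg_nonneg mult_nonneg_nonneg) (auto simp: r_def)
    qed
    also have "\<dots> = exp (- ((1 - exp (- 1 / 2)) * real N * word_prob p w))"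
      by (simp add: exp_of_nat_mult[symmetric] r_def x_def mult_ac)
    finally show "(\<Sum>b\<in>Pow {1..N}. (\<Prod>j\<in>b. x * r) * (\<Prod>j\<in>{1..N} - b. 1 - x)) \<le>
        exp (- ((1 - exp (- 1 / 2)) * real N * word_prob p w))" .
    show "AE \<omega> in M. (\<forall>n\<in>{N..<2 * N}. \<not> (U n \<omega> \<in> {1..N} \<and> S (U n \<omega>) \<omega> \<in> cylinder w)) \<longrightarrow>
        (\<exists>b\<in>Pow {1..N}. ?Q b \<omega>)"
    proof (intro AE_I2 impI)
      fix \<omega>
      assume no_hit: "\<forall>n\<in>{N..<2 * N}. \<not> (U n \<omega> \<in> {1..N} \<and> S (U n \<omega>) \<omega> \<in> cylinder w)"
      have "?Q {j \<in> {1..N}. S j \<omega> \<in> cylinder w} \<omega>"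
        using no_hit by auto
      then show "\<exists>b\<in>Pow {1..N}. ?Q b \<omega>"
        by blast
    qed
  qed
qed

text \<open>Summation over the \<open>n\<close> equally likely values of \<open>U n\<close>; other values have probability 0.\<close>

lemma outer_le_uniform_leaf:
  assumes "n \<ge> 1" "\<And>i. i \<in> {1..n} \<Longrightarrow> outer_le (\<lambda>\<omega>. U n \<omega> \<in> {i} \<and> Q i \<omega>) (1 / real n * b)"
  shows "outer_le (\<lambda>\<omega>. Q (U n \<omega>) \<omega>) b"
proof -
  have "outer_le (\<lambda>\<omega>. (\<forall>j\<in>{}. S j \<omega> \<in> UNIV) \<and> (\<forall>n'\<in>{n}. U n' \<omega> \<in> - {1..n})) 0"
    using assms(1) by (intro outer_le_SU) auto
  moreover have "outer_le (\<lambda>\<omega>. \<exists>i\<in>{1..n}. U n \<omega> \<in> {i} \<and> Q i \<omega>) (\<Sum>i\<in>{1..n}. 1 / real n * b)"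
    using assms(2) by (intro outer_le_Bex) auto
  ultimately have "outer_le (\<lambda>\<omega>. ((\<forall>j\<in>{}. S j \<omega> \<in> UNIV) \<and> (\<forall>n'\<in>{n}. U n' \<omega> \<in> - {1..n})) \<or>
      (\<exists>i\<in>{1..n}. U n \<omega> \<in> {i} \<and> Q i \<omega>)) (0 + (\<Sum>i\<in>{1..n}. 1 / real n * b))"
    by (rule outer_le_disj)
  then show ?thesis
    using assms(1) by (elim outer_le_mono) auto
qed

end

section \<open>Measurability of the typical depth\<close>

text \<open>Only countably many trees are possible, so it suffices to show that each of them arises on a
  measurable event.\<close>

instance bintree :: (countable) countable
  by countable_datatype

text \<open>Induction on the tree that is to be obtained.  For a branching tree, the event is split according
  to the set \<open>J\<close> of the indices whose strings start with \<open>True\<close>, which makes the index sets of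
  the two subtrees deterministic.\<close>

lemma trie_measurable:
  fixes f :: "'i \<Rightarrow> 'b \<Rightarrow> bool stream"
  assumes "finite I" "\<And>i. i \<in> I \<Longrightarrow> f i \<in> measurable N (stream_space (count_space UNIV))"
  shows "Measurable.pred N (\<lambda>\<omega>. trie (\<lambda>i. f i \<omega>) I = t)"
  using assms
proof (induction t arbitrary: f I)
  have inj: "Measurable.pred N (\<lambda>\<omega>. inj_on (\<lambda>i. f i \<omega>) I)"
    if I: "finite I" and f: "\<And>i. i \<in> I \<Longrightarrow> f i \<in> measurable N (stream_space (count_space UNIV))"
    for f :: "'i \<Rightarrow> 'b \<Rightarrow> bool stream" and I
  proof -
    have bit: "(\<lambda>\<omega>. f i \<omega> !! k) \<in> measurable N (count_space UNIV)" if "i \<in> I" for i k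
      by (rule measurable_compose[OF f[OF that] measurable_snth])
    have stream_eq: "x = y \<longleftrightarrow> (\<forall>k. x !! k = y !! k)" for x y :: "bool stream"
      using smap_alt[of id x y] by (simp add: stream.map_id)
    have "inj_on (\<lambda>i. f i \<omega>) I \<longleftrightarrow> (\<forall>i\<in>I. \<forall>j\<in>I. i = j \<or> (\<exists>k. f i \<omega> !! k \<noteq> f j \<omega> !! k))" for \<omega>
      unfolding inj_on_def stream_eq by blast
    moreover have "Measurable.pred N (\<lambda>\<omega>. \<forall>i\<in>I. \<forall>j\<in>I. i = j \<or> (\<exists>k. f i \<omega> !! k \<noteq> f j \<omega> !! k))"
      using bit I by measurable
    ultimately show ?thesis
      by simp
  qed
  {
    case Empty
    have "trie (\<lambda>i. f i \<omega>) I = Empty \<longleftrightarrow> \<not> inj_on (\<lambda>i. f i \<omega>) I \<or> I = {}" for \<omega>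
      using Empty(1) by (subst trie.simps) auto
    then show ?case
      using inj[OF Empty] by simp
  next
    case (Stored x)
    have "trie (\<lambda>i. f i \<omega>) I = Stored x \<longleftrightarrow> inj_on (\<lambda>i. f i \<omega>) I \<and> I = {x}" for \<omega>
      using Stored(1) by (subst trie.simps) (auto simp: card_1_singleton_iff)
    then show ?case
      using inj[OF Stored] by simp
  next
    case (Branch l r)
    have *: "trie (\<lambda>i. f i \<omega>) I = Branch l r \<longleftrightarrow>
        inj_on (\<lambda>i. f i \<omega>) I \<and> I \<noteq> {} \<and> card I \<noteq> 1 \<and>
        (\<exists>J\<in>Pow I. (\<forall>i\<in>I. shd (f i \<omega>) \<longleftrightarrow> i \<in> J) \<and>
           trie (\<lambda>i. stl (f i \<omega>)) (I - J) = l \<and> trie (\<lambda>i. stl (f i \<omega>)) J = r)" for \<omega>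
    proof -
      have J: "{i \<in> I. shd (f i \<omega>)} = J \<and> {i \<in> I. \<not> shd (f i \<omega>)} = I - J"
        if "J \<in> Pow I" "\<forall>i\<in>I. shd (f i \<omega>) \<longleftrightarrow> i \<in> J" for J
        using that by auto
      have "trie (\<lambda>i. f i \<omega>) I = Branch l r \<longleftrightarrow>
        inj_on (\<lambda>i. f i \<omega>) I \<and> I \<noteq> {} \<and> card I \<noteq> 1 \<and>
        trie (\<lambda>i. stl (f i \<omega>)) {i \<in> I. \<not> shd (f i \<omega>)} = l \<and> trie (\<lambda>i. stl (f i \<omega>)) {i \<in> I. shd (f i \<omega>)} = r"
        using Branch.prems(1) by (subst trie.simps) auto
      also have "trie (\<lambda>i. stl (f i \<omega>)) {i \<in> I. \<not> shd (f i \<omega>)} = l \<and>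
          trie (\<lambda>i. stl (f i \<omega>)) {i \<in> I. shd (f i \<omega>)} = r \<longleftrightarrow>
        (\<exists>J\<in>Pow I. (\<forall>i\<in>I. shd (f i \<omega>) \<longleftrightarrow> i \<in> J) \<and>
           trie (\<lambda>i. stl (f i \<omega>)) (I - J) = l \<and> trie (\<lambda>i. stl (f i \<omega>)) J = r)"
      proof
        assume "trie (\<lambda>i. stl (f i \<omega>)) {i \<in> I. \<not> shd (f i \<omega>)} = l \<and>
          trie (\<lambda>i. stl (f i \<omega>)) {i \<in> I. shd (f i \<omega>)} = r"
        moreover have "I - {i \<in> I. shd (f i \<omega>)} = {i \<in> I. \<not> shd (f i \<omega>)}"
          by auto
        ultimately show "\<exists>J\<in>Pow I. (\<forall>i\<in>I. shd (f i \<omega>) \<longleftrightarrow> i \<in> J) \<and>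
           trie (\<lambda>i. stl (f i \<omega>)) (I - J) = l \<and> trie (\<lambda>i. stl (f i \<omega>)) J = r"
          by (intro bexI[of _ "{i \<in> I. shd (f i \<omega>)}"]) auto
      next
        assume "\<exists>J\<in>Pow I. (\<forall>i\<in>I. shd (f i \<omega>) \<longleftrightarrow> i \<in> J) \<and>
           trie (\<lambda>i. stl (f i \<omega>)) (I - J) = l \<and> trie (\<lambda>i. stl (f i \<omega>)) J = r"
        then obtain J where "J \<in> Pow I" "\<forall>i\<in>I. shd (f i \<omega>) \<longleftrightarrow> i \<in> J"
           "trie (\<lambda>i. stl (f i \<omega>)) (I - J) = l" "trie (\<lambda>i. stl (f i \<omega>)) J = r"
          by blast
        with J[of J] show "trie (\<lambda>i. stl (f i \<omega>)) {i \<in> I. \<not> shd (f i \<omega>)} = l \<and>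
          trie (\<lambda>i. stl (f i \<omega>)) {i \<in> I. shd (f i \<omega>)} = r"
          by simp
      qed
      finally show ?thesis .
    qed
    have shd: "(\<lambda>\<omega>. shd (f i \<omega>)) \<in> measurable N (count_space UNIV)" if "i \<in> I" for i
      by (rule measurable_compose[OF Branch.prems(2)[OF that] measurable_shd])
    have stl: "(\<lambda>\<omega>. stl (f i \<omega>)) \<in> measurable N (stream_space (count_space UNIV))" if "i \<in> I" for i
      by (rule measurable_compose[OF Branch.prems(2)[OF that] measurable_stl])
    have "Measurable.pred N (\<lambda>\<omega>. trie (\<lambda>i. stl (f i \<omega>)) (I - J) = l)"
      "Measurable.pred N (\<lambda>\<omega>. trie (\<lambda>i. stl (f i \<omega>)) J = r)" if "J \<in> Pow I" for J
      using that stl Branch.prems(1) by (auto intro!: Branch.IH intro: finite_subset)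
    moreover have "Measurable.pred N (\<lambda>\<omega>. \<forall>i\<in>I. shd (f i \<omega>) \<longleftrightarrow> i \<in> J)" for J
      using shd Branch.prems(1) by measurable
    moreover have "finite (Pow I)"
      using Branch.prems(1) by simp
    ultimately have "Measurable.pred N (\<lambda>\<omega>. \<exists>J\<in>Pow I. (\<forall>i\<in>I. shd (f i \<omega>) \<longleftrightarrow> i \<in> J) \<and>
           trie (\<lambda>i. stl (f i \<omega>)) (I - J) = l \<and> trie (\<lambda>i. stl (f i \<omega>)) J = r)"
      by (intro pred_intros_finite pred_intros_logic) (auto intro: shd)
    then show ?case
      unfolding * using inj[OF Branch.prems] by measurable
  }
qed

context biased_patricia
begin

lemma typical_depth_measurable: "typical_depth S U n \<in> measurable M (count_space UNIV)"
proof (cases "n = 0")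
  case True
  have "trie f {} = Empty" for f :: "nat \<Rightarrow> bool stream"
    by (subst trie.simps) simp
  with True have "typical_depth S U n = (\<lambda>_. 0)"
    by (simp add: typical_depth_def patricia_def fun_eq_iff)
  then show ?thesis
    by simp
next
  case False
  have "(\<lambda>\<omega>. trie (\<lambda>i. S i \<omega>) {1..n}) \<in> measurable M (count_space UNIV)"
  proof (subst measurable_count_space_eq_countable)
    have "Measurable.pred M (\<lambda>\<omega>. trie (\<lambda>i. S i \<omega>) {1..n} = t)" for t
      using S_measurable by (intro trie_measurable) auto
    then have "{\<omega> \<in> space M. trie (\<lambda>i. S i \<omega>) {1..n} = t} \<in> events" for t
      by (simp add: pred_def)
    moreover have "(\<lambda>\<omega>. trie (\<lambda>i. S i \<omega>) {1..n}) -` {t} \<inter> space M =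
        {\<omega> \<in> space M. trie (\<lambda>i. S i \<omega>) {1..n} = t}" for t
      by auto
    ultimately show "(\<lambda>\<omega>. trie (\<lambda>i. S i \<omega>) {1..n}) \<in> space M \<rightarrow> UNIV \<and>
        (\<forall>t\<in>UNIV. (\<lambda>\<omega>. trie (\<lambda>i. S i \<omega>) {1..n}) -` {t} \<inter> space M \<in> events)"
      by simp
  qed simp
  moreover have "(\<lambda>\<omega>. leaf_depth (compress t) (U n \<omega>)) \<in> measurable M (count_space UNIV)" for t
    using False by (intro measurable_compose[OF U_measurable]) auto
  ultimately have "(\<lambda>\<omega>. leaf_depth (compress (trie (\<lambda>i. S i \<omega>) {1..n})) (U n \<omega>))
      \<in> measurable M (count_space UNIV)"
    by (rule measurable_compose_countable[rotated])
  moreover have "typical_depth S U n = (\<lambda>\<omega>. leaf_depth (compress (trie (\<lambda>i. S i \<omega>) {1..n})) (U n \<omega>))"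
    by (simp add: typical_depth_def patricia_def fun_eq_iff)
  ultimately show ?thesis
    by simp
qed

section \<open>Tail bounds for the typical depth\<close>

lemma AE_U_range: "AE \<omega> in M. \<forall>n\<ge>1. U n \<omega> \<in> {1..n}"
proof -
  have "AE \<omega> in M. \<not> (\<forall>n'\<in>{n}. U n' \<omega> \<in> - {1..n})" if "1 \<le> n" for n
  proof -
    have "outer_le (\<lambda>\<omega>. (\<forall>j\<in>{}. S j \<omega> \<in> UNIV) \<and> (\<forall>n'\<in>{n}. U n' \<omega> \<in> - {1..n})) 0"
      using that by (intro outer_le_SU) auto
    then show ?thesis
      by (intro AE_not_of_outer_le_tendsto[where b = "\<lambda>_. 0"]) auto
  qed
  then have "AE \<omega> in M. 1 \<le> n \<longrightarrow> U n \<omega> \<in> {1..n}" for n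
    by (cases "1 \<le> n") auto
  then show ?thesis
    by (subst AE_all_countable) blast
qed

lemma outer_le_crowd_uniform:
  assumes "i \<in> {1..n}" "W \<subseteq> {w. length w = L}" "\<And>w. w \<in> W \<Longrightarrow> word_prob p w \<le> c"
  shows "outer_le (\<lambda>\<omega>. U n \<omega> \<in> C \<and> stake L (S i \<omega>) \<in> W \<and>
            m \<le> card {j \<in> {1..n} - {i}. stake L (S j \<omega>) = stake L (S i \<omega>)})
           (real (card (C \<inter> {1..n})) / real n * ((\<Sum>w\<in>W. word_prob p w) * (real n * c) ^ m))"
proof (rule outer_le_mono[OF outer_le_crowd[OF assms(1,2)]])
  show "real (card (C \<inter> {1..n})) / real n * (\<Sum>w\<in>W. word_prob p w * (real n * word_prob p w) ^ m) \<le>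
      real (card (C \<inter> {1..n})) / real n * ((\<Sum>w\<in>W. word_prob p w) * (real n * c) ^ m)"
    unfolding sum_distrib_right
    using assms(3) by (intro mult_left_mono sum_mono power_mono) (auto intro: wp_nonneg mult_nonneg_nonneg)
qed auto

lemma AE_distinct_strings: "AE \<omega> in M. inj_on (\<lambda>i. S i \<omega>) {1..}"
proof -
  have "AE \<omega> in M. \<not> S j \<omega> = S i \<omega>" if ij: "1 \<le> i" "i < j" for i j
  proof (rule AE_not_of_outer_le_tendsto)
    have "outer_le (\<lambda>\<omega>. S j \<omega> = S i \<omega>) (real j * p ^ L)" for L
    proof (rule outer_le_mono)
      let ?W = "{w :: bool list. length w = L}"
      show "outer_le (\<lambda>\<omega>. U j \<omega> \<in> UNIV \<and> stake L (S i \<omega>) \<in> ?W \<and>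
          1 \<le> card {j' \<in> {1..j} - {i}. stake L (S j' \<omega>) = stake L (S i \<omega>)})
          (real (card (UNIV \<inter> {1..j})) / real j * ((\<Sum>w\<in>?W. word_prob p w) * (real j * p ^ L) ^ 1))"
        using ij word_prob_le[OF half_less_p p_less_1] by (intro outer_le_crowd_uniform) auto
      show "real (card (UNIV \<inter> {1..j})) / real j * ((\<Sum>w\<in>?W. word_prob p w) * (real j * p ^ L) ^ 1) \<le> real j * p ^ L"
        using ij by (simp add: sum_word_prob)
      have "1 \<le> card {j' \<in> {1..j} - {i}. stake L (S j' \<omega>) = stake L (S i \<omega>)}" if "S j \<omega> = S i \<omega>" for \<omega>
      proof -
        have "card {j} \<le> card {j' \<in> {1..j} - {i}. stake L (S j' \<omega>) = stake L (S i \<omega>)}"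
          using that ij by (intro card_mono) auto
        then show ?thesis
          by simp
      qed
      then show "AE \<omega> in M. S j \<omega> = S i \<omega> \<longrightarrow> U j \<omega> \<in> UNIV \<and> stake L (S i \<omega>) \<in> ?W \<and>
          1 \<le> card {j' \<in> {1..j} - {i}. stake L (S j' \<omega>) = stake L (S i \<omega>)}"
        by auto
    qed
    then show "\<forall>\<^sub>F L in sequentially. outer_le (\<lambda>\<omega>. S j \<omega> = S i \<omega>) (real j * p ^ L)"
      by simp
    show "(\<lambda>L. real j * p ^ L) \<longlonglongrightarrow> 0"
      using p_pos p_less_1 by (intro tendsto_mult_right_zero LIMSEQ_power_zero) auto
  qed
  then have "AE \<omega> in M. 1 \<le> i \<longrightarrow> i < j \<longrightarrow> S j \<omega> \<noteq> S i \<omega>" for i j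
    by (cases "1 \<le> i \<and> i < j") auto
  then have "AE \<omega> in M. \<forall>i j. 1 \<le> i \<longrightarrow> i < j \<longrightarrow> S j \<omega> \<noteq> S i \<omega>"
    by (simp add: AE_all_countable)
  then show ?thesis
    by eventually_elim (auto simp: inj_on_def, metis linorder_neqE_nat)
qed

text \<open>Outside a null set the strings are distinct and \<open>U n\<close> is a leaf, so the typical depth is the
  number of branchings.\<close>

lemma AE_typical_depth:
  "AE \<omega> in M. \<forall>n\<ge>1. U n \<omega> \<in> {1..n} \<and>
     typical_depth S U n \<omega> = card (branch_levels (\<lambda>i. S i \<omega>) {1..n} (U n \<omega>))"
  using AE_U_range AE_distinct_strings
proof eventually_elim
  case (elim \<omega>)
  have "inj_on (\<lambda>i. S i \<omega>) {1..n}" for n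
    using elim(2) by (rule inj_on_subset) auto
  with elim(1) show ?case
    by (auto simp: typical_depth_def leaf_depth_patricia)
qed

lemma outer_le_prefix:
  assumes "n \<ge> 1" "W \<subseteq> {w. length w = L}"
  shows "outer_le (\<lambda>\<omega>. stake L (S (U n \<omega>) \<omega>) \<in> W) (\<Sum>w\<in>W. word_prob p w)"
proof (rule outer_le_uniform_leaf[OF assms(1)])
  fix i assume i: "i \<in> {1..n}"
  show "outer_le (\<lambda>\<omega>. U n \<omega> \<in> {i} \<and> stake L (S i \<omega>) \<in> W) (1 / real n * (\<Sum>w\<in>W. word_prob p w))"
    using i by (intro outer_le_mono[OF outer_le_crowd[OF i assms(2), of "{i}" 0]]) auto
qed

text \<open>A leaf at depth \<open>L + m\<close> shares its first \<open>L\<close> bits with \<open>m\<close> other strings.\<close>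

lemma outer_le_depth_ge:
  assumes "n \<ge> 1" "W \<subseteq> {w. length w = L}" "\<And>w. w \<in> W \<Longrightarrow> word_prob p w \<le> c" "0 \<le> c"
  shows "outer_le (\<lambda>\<omega>. stake L (S (U n \<omega>) \<omega>) \<in> W \<and> L + m \<le> typical_depth S U n \<omega>) ((real n * c) ^ m)"
proof -
  have "outer_le (\<lambda>\<omega>. stake L (S (U n \<omega>) \<omega>) \<in> W \<and>
      m \<le> card {j \<in> {1..n} - {U n \<omega>}. stake L (S j \<omega>) = stake L (S (U n \<omega>) \<omega>)}) ((real n * c) ^ m)"
  proof (rule outer_le_uniform_leaf[OF assms(1)])
    fix i assume i: "i \<in> {1..n}"
    have "(\<Sum>w\<in>W. word_prob p w) * (real n * c) ^ m \<le> (real n * c) ^ m"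
      using sum_word_prob_le_1[OF p_pos p_less_1 assms(2)] assms(4)
      by (intro mult_left_le_one_le) (auto intro: sum_nonneg wp_nonneg)
    then show "outer_le (\<lambda>\<omega>. U n \<omega> \<in> {i} \<and> stake L (S i \<omega>) \<in> W \<and>
      m \<le> card {j \<in> {1..n} - {i}. stake L (S j \<omega>) = stake L (S i \<omega>)}) (1 / real n * (real n * c) ^ m)"
      using i by (intro outer_le_mono[OF outer_le_crowd_uniform[OF i assms(2,3), of "{i}" m]])
        (auto intro: divide_right_mono)
  qed
  then show ?thesis
  proof (rule outer_le_mono)
    show "AE \<omega> in M. stake L (S (U n \<omega>) \<omega>) \<in> W \<and> L + m \<le> typical_depth S U n \<omega> \<longrightarrow>
        stake L (S (U n \<omega>) \<omega>) \<in> W \<and>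
        m \<le> card {j \<in> {1..n} - {U n \<omega>}. stake L (S j \<omega>) = stake L (S (U n \<omega>) \<omega>)}"
      using AE_typical_depth
    proof eventually_elim
      case (elim \<omega>)
      then have "typical_depth S U n \<omega> = card (branch_levels (\<lambda>i. S i \<omega>) {1..n} (U n \<omega>))"
        using assms(1) by blast
      then show ?case
        using card_branch_levels_le[of "{1..n}" "\<lambda>i. S i \<omega>" "U n \<omega>" L] by auto
    qed
  qed simp
qed

text \<open>A leaf at depth below \<open>k\<close> has a level below \<open>k\<close> that does not branch.\<close>

lemma outer_le_depth_less:
  assumes "n \<ge> 1" "W \<subseteq> {w. length w = k}" "\<And>w. w \<in> W \<Longrightarrow> c \<le> word_prob p w"
  shows "outer_le (\<lambda>\<omega>. stake k (S (U n \<omega>) \<omega>) \<in> W \<and> typical_depth S U n \<omega> < k)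
           (real k * exp (- (real (n - 1) * ((1 - p) * c))))"
proof -
  let ?e = "exp (- (real (n - 1) * ((1 - p) * c)))"
  have "outer_le (\<lambda>\<omega>. stake k (S (U n \<omega>) \<omega>) \<in> W \<and>
      \<not> {..<k} \<subseteq> branch_levels (\<lambda>j. S j \<omega>) {1..n} (U n \<omega>)) (real k * ?e)"
  proof (rule outer_le_uniform_leaf[OF assms(1)])
    fix i assume i: "i \<in> {1..n}"
    have "(\<Sum>w\<in>W. word_prob p w * (real k * exp (- (real (n - 1) * ((1 - p) * word_prob p w))))) \<le>
        (\<Sum>w\<in>W. word_prob p w * (real k * ?e))"
      using assms(3) p_less_1 by (intro sum_mono mult_left_mono wp_nonneg) (auto intro!: mult_left_mono)
    also have "\<dots> = (\<Sum>w\<in>W. word_prob p w) * (real k * ?e)"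
      by (simp add: sum_distrib_right)
    also have "\<dots> \<le> real k * ?e"
      using sum_word_prob_le_1[OF p_pos p_less_1 assms(2)]
      by (intro mult_left_le_one_le) (auto intro: sum_nonneg wp_nonneg)
    finally show "outer_le (\<lambda>\<omega>. U n \<omega> \<in> {i} \<and> stake k (S i \<omega>) \<in> W \<and>
      \<not> {..<k} \<subseteq> branch_levels (\<lambda>j. S j \<omega>) {1..n} i) (1 / real n * (real k * ?e))"
      using i by (intro outer_le_mono[OF outer_le_gap[OF i assms(2), of "{i}"]])
        (auto intro: divide_right_mono)
  qed
  then show ?thesis
  proof (rule outer_le_mono)
    show "AE \<omega> in M. stake k (S (U n \<omega>) \<omega>) \<in> W \<and> typical_depth S U n \<omega> < k \<longrightarrow>
        stake k (S (U n \<omega>) \<omega>) \<in> W \<and> \<not> {..<k} \<subseteq> branch_levels (\<lambda>j. S j \<omega>) {1..n} (U n \<omega>)"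
      using AE_typical_depth
    proof eventually_elim
      case (elim \<omega>)
      then have "typical_depth S U n \<omega> = card (branch_levels (\<lambda>i. S i \<omega>) {1..n} (U n \<omega>))"
        using assms(1) by blast
      then show ?case
        using card_branch_levels_ge[of "{1..n}" k "\<lambda>i. S i \<omega>" "U n \<omega>"] by auto
    qed
  qed simp
qed

section \<open>Almost sure bounds for the typical depth\<close>

text \<open>The probability of a word of length \<open>k\<close> lies between \<open>exp (- \<nu> * k)\<close>, attained
  by a run of \<open>False\<close>, and \<open>exp (- \<mu> * k)\<close>, attained by a run of \<open>True\<close>.\<close>

definition "\<mu> = ln (1 / p)"
definition "\<nu> = ln (1 / (1 - p))"

lemma \<mu>_pos: "0 < \<mu>"
  using p_pos p_less_1 by (simp add: \<mu>_def)

lemma \<mu>_less_\<nu>: "\<mu> < \<nu>"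
  using half_less_p p_less_1 unfolding \<mu>_def \<nu>_def by (subst ln_less_cancel_iff) (auto simp: divide_simps)

lemma \<nu>_pos: "0 < \<nu>"
  using \<mu>_pos \<mu>_less_\<nu> by simp

lemma p_power: "p ^ k = exp (- \<mu> * real k)"
proof -
  have "exp (- \<mu>) = p"
    using p_pos by (simp add: \<mu>_def ln_div)
  then show ?thesis
    by (metis exp_of_nat2_mult)
qed

lemma q_power: "(1 - p) ^ k = exp (- \<nu> * real k)"
proof -
  have "exp (- \<nu>) = 1 - p"
    using p_less_1 by (simp add: \<nu>_def ln_div)
  then show ?thesis
    by (metis exp_of_nat2_mult)
qed

text \<open>With \<open>\<delta> = a * \<mu> - 1 > 0\<close>, words of length about \<open>a * ln n\<close> have probability at most a
  constant times \<open>n powr (- 1 - \<delta>)\<close>, so that \<open>m\<close> companions have probability at most a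
  constant times \<open>n powr (- \<delta> * m)\<close>.  A constant \<open>m\<close> makes this summable and changes the depth only by a constant.\<close>

lemma AE_eventually_depth_less:
  assumes "1 / \<mu> < a"
  shows "AE \<omega> in M. \<forall>\<^sub>F n in sequentially. \<not> a * ln (real n) \<le> real (typical_depth S U n \<omega>)"
proof -
  define \<delta> where "\<delta> = a * \<mu> - 1"
  have "0 < \<delta>"
    using assms \<mu>_pos by (simp add: \<delta>_def field_simps)
  have "0 < a"
    using assms \<mu>_pos by (meson less_trans zero_less_divide_1_iff)
  \<comment> \<open>the crowd size that makes the tail \<open>n powr (- \<delta> * m)\<close> summable\<close>
  obtain m :: nat where m: "2 / \<delta> < real m"
    using reals_Archimedean2 by blast
  then have m2: "2 < \<delta> * real m"
    using \<open>0 < \<delta>\<close> by (simp add: field_simps)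
  define C where "C = exp (\<mu> * (1 + real m)) ^ m"
  show ?thesis
  proof (rule AE_eventually_not_of_summable)
    have "\<forall>\<^sub>F n::nat in sequentially. real m + 1 < a * ln (real n)"
      using \<open>0 < a\<close> by real_asymp
    then show "\<forall>\<^sub>F n in sequentially. outer_le (\<lambda>\<omega>. a * ln (real n) \<le> real (typical_depth S U n \<omega>))
        (C * real n powr (- \<delta> * real m))"
      using eventually_ge_at_top[of 1]
    proof eventually_elim
      case (elim n)
      define L where "L = nat \<lfloor>a * ln (real n)\<rfloor> - m"
      have fl: "int m \<le> \<lfloor>a * ln (real n)\<rfloor>"
        using elim(1) by linarith
      then have Lm: "L + m = nat \<lfloor>a * ln (real n)\<rfloor>"
        unfolding L_def by linarith
      have L_ge: "a * ln (real n) - 1 - real m \<le> real L"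
        using Lm fl by linarith
      have "p ^ L \<le> exp (- \<mu> * (a * ln (real n) - 1 - real m))"
        unfolding p_power using L_ge \<mu>_pos by simp
      then have "real n * p ^ L \<le> exp (ln (real n)) * exp (- \<mu> * (a * ln (real n) - 1 - real m))"
        using elim(2) by (simp add: mult_left_mono)
      also have "\<dots> = exp (\<mu> * (1 + real m)) * exp (- \<delta> * ln (real n))"
        by (simp add: \<delta>_def exp_add[symmetric] algebra_simps)
      also have "exp (- \<delta> * ln (real n)) = real n powr (- \<delta>)"
        using elim(2) by (simp add: powr_def)
      finally have "(real n * p ^ L) ^ m \<le> (exp (\<mu> * (1 + real m)) * real n powr (- \<delta>)) ^ m"
        using p_pos by (intro power_mono) auto
      also have "\<dots> = C * real n powr (- \<delta> * real m)"
      proof -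
        have "(real n powr (- \<delta>)) ^ m = real n powr (- \<delta> * real m)"
          using elim(2) by (subst powr_powr[symmetric], subst powr_realpow) auto
        then show ?thesis
          by (simp add: C_def power_mult_distrib)
      qed
      finally have bound: "(real n * p ^ L) ^ m \<le> C * real n powr (- \<delta> * real m)" .
      show ?case
      proof (rule outer_le_mono)
        show "outer_le (\<lambda>\<omega>. stake L (S (U n \<omega>) \<omega>) \<in> {w. length w = L} \<and> L + m \<le> typical_depth S U n \<omega>)
            ((real n * p ^ L) ^ m)"
          using elim(2) word_prob_le[OF half_less_p p_less_1] p_pos by (intro outer_le_depth_ge) auto
        have "nat \<lfloor>a * ln (real n)\<rfloor> \<le> typical_depth S U n \<omega>"
          if "a * ln (real n) \<le> real (typical_depth S U n \<omega>)" for \<omega>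
          using that by linarith
        then show "AE \<omega> in M. a * ln (real n) \<le> real (typical_depth S U n \<omega>) \<longrightarrow>
            stake L (S (U n \<omega>) \<omega>) \<in> {w. length w = L} \<and> L + m \<le> typical_depth S U n \<omega>"
          unfolding Lm by auto
      qed (rule bound)
    qed
    show "summable (\<lambda>n. C * real n powr (- \<delta> * real m))"
      using m2 by (intro summable_mult) (simp add: summable_real_powr_iff)
  qed
qed

text \<open>Even the least likely word of length \<open>k\<close> slightly below \<open>ln n / \<nu>\<close> is the prefix of a
  positive power of \<open>n\<close> many strings on average, so a missing branching above that level is
  superpolynomially unlikely.\<close>

lemma AE_eventually_depth_ge:
  assumes "0 < a" "a < 1 / \<nu>"
  shows "AE \<omega> in M. \<forall>\<^sub>F n in sequentially. \<not> real (typical_depth S U n \<omega>) < a * ln (real n)"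
proof -
  define \<beta> where "\<beta> = \<nu> * a"
  have \<beta>: "0 < \<beta>" "\<beta> < 1"
    using assms \<nu>_pos by (auto simp: \<beta>_def field_simps)
  define C where "C = (1 - p) * exp (- \<nu>)"
  have "0 < C"
    using p_less_1 by (simp add: C_def)
  let ?b = "\<lambda>n. (a * ln (real n) + 1) * exp (- ((real n - 1) * (C * real n powr (-\<beta>))))"
  show ?thesis
  proof (rule AE_eventually_not_of_summable)
    show "\<forall>\<^sub>F n in sequentially. outer_le (\<lambda>\<omega>. real (typical_depth S U n \<omega>) < a * ln (real n)) (?b n)"
      using eventually_ge_at_top[of 1]
    proof eventually_elim
      case (elim n)
      define k where "k = nat \<lceil>a * ln (real n)\<rceil>"
      have "0 \<le> a * ln (real n)"
        using elim assms(1) by simp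
      then have k_le: "real k \<le> a * ln (real n) + 1"
        unfolding k_def by linarith
      \<comment> \<open>the factor \<open>exp (- \<nu>)\<close> pays for rounding up \<open>k\<close>\<close>
      define c where "c = exp (- \<nu>) * real n powr (- \<beta>)"
      have "c = exp (- \<nu> * (a * ln (real n) + 1))"
        using elim by (simp add: c_def \<beta>_def powr_def exp_add[symmetric] algebra_simps)
      also have "\<dots> \<le> (1 - p) ^ k"
        unfolding q_power using k_le \<nu>_pos by simp
      finally have c: "c \<le> (1 - p) ^ k" .
      show ?case
      proof (rule outer_le_mono)
        show "outer_le (\<lambda>\<omega>. stake k (S (U n \<omega>) \<omega>) \<in> {w. length w = k} \<and> typical_depth S U n \<omega> < k)
            (real k * exp (- (real (n - 1) * ((1 - p) * c))))"
          using elim c word_prob_ge[OF half_less_p p_less_1] by (intro outer_le_depth_less) (auto intro: order_trans)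
        show "real k * exp (- (real (n - 1) * ((1 - p) * c))) \<le> ?b n"
          using k_le elim by (intro mult_mono) (auto simp: C_def c_def of_nat_diff mult_ac)
        have "typical_depth S U n \<omega> < k"
          if "real (typical_depth S U n \<omega>) < a * ln (real n)" for \<omega>
          using that unfolding k_def by linarith
        then show "AE \<omega> in M. real (typical_depth S U n \<omega>) < a * ln (real n) \<longrightarrow>
            stake k (S (U n \<omega>) \<omega>) \<in> {w. length w = k} \<and> typical_depth S U n \<omega> < k"
          by auto
      qed
    qed
    have "?b \<in> O(\<lambda>n. real n powr (-2))"
      using \<beta> \<open>0 < C\<close> assms(1) by real_asymp
    moreover have "summable (\<lambda>n. norm (real n powr (-2)))"
      by (simp add: summable_real_powr_iff)
    ultimately show "summable ?b"
      by (rule summable_comparison_test_bigo[rotated])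
  qed
qed

text \<open>Slightly below level \<open>ln N / \<mu>\<close> a run \<open>w\<close> of \<open>True\<close> is still the prefix of a positive power
  of \<open>N\<close> many strings, and some leaf chosen in the block \<open>N \<le> n < 2 * N\<close> is one of
  them.  Every level along \<open>w\<close> already branches in the tree on the first \<open>N\<close> strings, and
  branchings persist, so this leaf has depth at least \<open>k\<close>.\<close>

lemma AE_frequently_depth_ge:
  assumes "0 < a" "a < 1 / \<mu>"
  shows "AE \<omega> in M. \<exists>\<^sub>F n in sequentially. a * ln (real n) \<le> real (typical_depth S U n \<omega>)"
proof -
  define \<beta> where "\<beta> = \<mu> * a"
  have \<beta>: "0 < \<beta>" "\<beta> < 1"
    using assms \<mu>_pos by (auto simp: \<beta>_def field_simps)
  define D :: real where "D = 1 - exp (- 1 / 2)"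
  define C where "C = (1 - p) * exp (- \<mu>)"
  have pos: "0 < C" "0 < D"
    using p_less_1 by (simp_all add: C_def D_def)
  let ?hit = "\<lambda>N. exp (- (D * exp (- \<mu>) * real N * (2 * real N) powr (-\<beta>)))"
  let ?bad = "\<lambda>N. real N * ((a * ln (2 * real N) + 1) * exp (- ((real N - 1) * (C * (2 * real N) powr (-\<beta>)))))"
  have "AE \<omega> in M. \<not> (\<forall>n\<ge>N0. real (typical_depth S U n \<omega>) < a * ln (real n))" for N0
  proof (rule AE_not_of_outer_le_tendsto)
    have "?hit \<longlonglongrightarrow> 0"
      using \<beta> pos by real_asymp
    moreover have "?bad \<longlonglongrightarrow> 0"
      using \<beta> pos assms(1) by real_asymp
    ultimately show "(\<lambda>N. ?hit N + ?bad N) \<longlonglongrightarrow> 0"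
      by (rule tendsto_add_zero)
    show "\<forall>\<^sub>F N in sequentially. outer_le (\<lambda>\<omega>. \<forall>n\<ge>N0. real (typical_depth S U n \<omega>) < a * ln (real n))
        (?hit N + ?bad N)"
      using eventually_ge_at_top[of "max 1 N0"]
    proof eventually_elim
      case (elim N)
      then have N: "1 \<le> N" "N0 \<le> N"
        by auto
      \<comment> \<open>\<open>2 * N\<close> instead of \<open>N\<close>, so that depth \<open>k\<close> is large enough for every \<open>n\<close> of the block\<close>
      define k where "k = nat \<lceil>a * ln (2 * real N)\<rceil>"
      define w where "w = replicate k True"
      have "0 \<le> a * ln (2 * real N)"
        using N assms(1) by simp
      then have k: "real k \<le> a * ln (2 * real N) + 1" "a * ln (2 * real N) \<le> real k"
        unfolding k_def by linarith+
      define c where "c = exp (- \<mu>) * (2 * real N) powr (- \<beta>)"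
      have "c = exp (- \<mu> * (a * ln (2 * real N) + 1))"
        using N by (simp add: c_def \<beta>_def powr_def exp_add[symmetric] algebra_simps)
      also have "\<dots> \<le> p ^ k"
        unfolding p_power using k(1) \<mu>_pos by simp
      finally have c: "c \<le> word_prob p w"
        by (simp add: w_def)
      have w1: "word_prob p w \<le> 1"
        using sum_word_prob_le_1[OF p_pos p_less_1, of "{w}" k] by (simp add: w_def)
      have hit: "outer_le (\<lambda>\<omega>. \<forall>n\<in>{N..<2 * N}. \<not> (U n \<omega> \<in> {1..N} \<and> S (U n \<omega>) \<omega> \<in> cylinder w)) (?hit N)"
      proof (rule outer_le_mono[OF outer_le_no_hit[OF N(1)]])
        have "D * real N * c \<le> D * real N * word_prob p w"
          using c pos by (intro mult_left_mono) auto
        then show "exp (- ((1 - exp (- 1 / 2)) * real N * word_prob p w)) \<le> ?hit N"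
          by (simp add: D_def c_def mult_ac)
      qed simp
      have "outer_le (\<lambda>\<omega>. U N \<omega> \<in> UNIV \<and> stake k (S i \<omega>) \<in> {w} \<and>
            \<not> {..<k} \<subseteq> branch_levels (\<lambda>j. S j \<omega>) {1..N} i)
          ((a * ln (2 * real N) + 1) * exp (- ((real N - 1) * (C * (2 * real N) powr (-\<beta>)))))"
        if i: "i \<in> {1..N}" for i
      proof (rule outer_le_mono[OF outer_le_gap[OF i]])
        have "exp (- (real (N - 1) * ((1 - p) * word_prob p w))) \<le>
            exp (- ((real N - 1) * (C * (2 * real N) powr (-\<beta>))))"
        proof -
          have "(real N - 1) * (C * (2 * real N) powr (-\<beta>)) = real (N - 1) * ((1 - p) * c)"
            using N by (simp add: C_def c_def of_nat_diff)
          also have "\<dots> \<le> real (N - 1) * ((1 - p) * word_prob p w)"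
            using c p_less_1 by (intro mult_left_mono) auto
          finally show ?thesis
            by simp
        qed
        then have "word_prob p w * (real k * exp (- (real (N - 1) * ((1 - p) * word_prob p w)))) \<le>
            1 * ((a * ln (2 * real N) + 1) * exp (- ((real N - 1) * (C * (2 * real N) powr (-\<beta>)))))"
          using k w1 wp_nonneg by (intro mult_mono) auto
        then show "real (card (UNIV \<inter> {1..N})) / real N *
            (\<Sum>w\<in>{w}. word_prob p w * (real k * exp (- (real (N - 1) * ((1 - p) * word_prob p w))))) \<le>
            (a * ln (2 * real N) + 1) * exp (- ((real N - 1) * (C * (2 * real N) powr (-\<beta>))))"
          using N by simp
      qed (auto simp: w_def)
      then have "outer_le (\<lambda>\<omega>. \<exists>i\<in>{1..N}. U N \<omega> \<in> UNIV \<and> stake k (S i \<omega>) \<in> {w} \<and>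
            \<not> {..<k} \<subseteq> branch_levels (\<lambda>j. S j \<omega>) {1..N} i)
          (\<Sum>i\<in>{1..N}. (a * ln (2 * real N) + 1) * exp (- ((real N - 1) * (C * (2 * real N) powr (-\<beta>)))))"
        by (intro outer_le_Bex) simp_all
      from outer_le_disj[OF hit this] show ?case
      proof (rule outer_le_mono)
        show "AE \<omega> in M. (\<forall>n\<ge>N0. real (typical_depth S U n \<omega>) < a * ln (real n)) \<longrightarrow>
            (\<forall>n\<in>{N..<2 * N}. \<not> (U n \<omega> \<in> {1..N} \<and> S (U n \<omega>) \<omega> \<in> cylinder w)) \<or>
            (\<exists>i\<in>{1..N}. U N \<omega> \<in> UNIV \<and> stake k (S i \<omega>) \<in> {w} \<and>
              \<not> {..<k} \<subseteq> branch_levels (\<lambda>j. S j \<omega>) {1..N} i)"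
          using AE_typical_depth
        proof eventually_elim
          case (elim \<omega>)
          show ?case
          proof (intro impI, rule ccontr)
            assume small: "\<forall>n\<ge>N0. real (typical_depth S U n \<omega>) < a * ln (real n)"
              and "\<not> ((\<forall>n\<in>{N..<2 * N}. \<not> (U n \<omega> \<in> {1..N} \<and> S (U n \<omega>) \<omega> \<in> cylinder w)) \<or>
            (\<exists>i\<in>{1..N}. U N \<omega> \<in> UNIV \<and> stake k (S i \<omega>) \<in> {w} \<and>
              \<not> {..<k} \<subseteq> branch_levels (\<lambda>j. S j \<omega>) {1..N} i))"
            then obtain n where n: "n \<in> {N..<2 * N}" "U n \<omega> \<in> {1..N}" "S (U n \<omega>) \<omega> \<in> cylinder w"
              and good: "\<And>i. i \<in> {1..N} \<Longrightarrow> stake k (S i \<omega>) = w \<Longrightarrow>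
                {..<k} \<subseteq> branch_levels (\<lambda>j. S j \<omega>) {1..N} i"
              by blast
            have "stake k (S (U n \<omega>) \<omega>) = w"
              using n(3) by (simp add: cylinder_def w_def)
            then have "{..<k} \<subseteq> branch_levels (\<lambda>j. S j \<omega>) {1..n} (U n \<omega>)"
              using good[OF n(2)] branch_levels_mono[of "{1..N}" "{1..n}" "\<lambda>j. S j \<omega>" "U n \<omega>"] n(1) by fastforce
            then have "k \<le> card (branch_levels (\<lambda>j. S j \<omega>) {1..n} (U n \<omega>))"
              by (intro card_branch_levels_ge) auto
            then have "k \<le> typical_depth S U n \<omega>"
              using elim n(1) N by auto
            moreover have "a * ln (real n) \<le> a * ln (2 * real N)"
              using n(1) N assms(1) by (intro mult_left_mono) auto
            moreover have "real (typical_depth S U n \<omega>) < a * ln (real n)"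
              using small n(1) N by auto
            ultimately show False
              using k(2) by linarith
          qed
        qed
      qed simp
    qed
  qed
  then have "AE \<omega> in M. \<forall>N0. \<not> (\<forall>n\<ge>N0. real (typical_depth S U n \<omega>) < a * ln (real n))"
    by (subst AE_all_countable) blast
  then show ?thesis
    by eventually_elim (simp add: frequently_def eventually_sequentially not_le)
qed

text \<open>Here the chosen leaf starts with a run \<open>w\<close> of \<open>False\<close> of length \<open>k\<close> slightly below
  \<open>ln N / \<nu>\<close>.  Only about \<open>N powr \<epsilon>\<close> of the first \<open>2 * N\<close> strings start with \<open>w\<close>, and a further
  \<open>L\<close> bits, where \<open>L\<close> is about \<open>3 * \<epsilon> * ln N / \<mu>\<close>, separate all of them: a pair of them
  agrees on these bits with probability at most \<open>N powr (- 3 * \<epsilon>)\<close>, whereas there are only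
  about \<open>N powr (2 * \<epsilon>)\<close> pairs.  Hence the depth is at most \<open>k + L\<close> throughout the block.\<close>

lemma AE_frequently_depth_le:
  assumes "1 / \<nu> < a"
  shows "AE \<omega> in M. \<exists>\<^sub>F n in sequentially. real (typical_depth S U n \<omega>) \<le> a * ln (real n)"
proof -
  have "0 < 1 / \<nu>"
    using \<nu>_pos by simp
  with assms have "0 < a"
    by (rule less_trans[rotated])
  \<comment> \<open>small enough that \<open>(1 - \<epsilon>) / \<nu> + 3 * \<epsilon> / \<mu> < a\<close>\<close>
  define \<epsilon> where "\<epsilon> = min (1 / 2) ((a - 1 / \<nu>) * \<mu> / 6)"
  define \<alpha> where "\<alpha> = 1 - \<epsilon>"
  have \<epsilon>: "0 < \<epsilon>" "\<epsilon> \<le> 1 / 2"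
    using assms \<mu>_pos by (simp_all add: \<epsilon>_def)
  have \<epsilon>_le: "\<epsilon> \<le> (a - 1 / \<nu>) * \<mu> / 6"
    unfolding \<epsilon>_def by (rule min.cobounded2)
  have \<alpha>: "0 < \<alpha>" "\<alpha> < 1"
    using \<epsilon> by (auto simp: \<alpha>_def)
  have sum_less: "\<alpha> / \<nu> + 3 * (1 - \<alpha>) / \<mu> < a"
  proof -
    have "3 * (1 - \<alpha>) / \<mu> \<le> (a - 1 / \<nu>) / 2"
      using \<epsilon>_le \<mu>_pos by (simp add: \<alpha>_def field_simps)
    moreover have "\<alpha> / \<nu> \<le> 1 / \<nu>"
      using \<alpha> \<nu>_pos by (intro divide_right_mono) auto
    ultimately show ?thesis
      using assms by argo
  qed
  define D :: real where "D = 1 - exp (- 1 / 2)"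
  have pos: "0 < D"
    by (simp add: D_def)
  define E where "E = 4 * exp \<nu> * exp \<nu>"
  let ?hit = "\<lambda>N. exp (- (D * real N * real N powr (-\<alpha>)))"
  let ?bad = "\<lambda>N. E * (real N powr (\<alpha> - 1))"
  have "AE \<omega> in M. \<not> (\<forall>n\<ge>N0. a * ln (real n) < real (typical_depth S U n \<omega>))" for N0
  proof (rule AE_not_of_outer_le_tendsto)
    have "?hit \<longlonglongrightarrow> 0"
      using \<alpha> pos by real_asymp
    moreover have "?bad \<longlonglongrightarrow> 0"
      using \<alpha> by real_asymp
    ultimately show "(\<lambda>N. ?hit N + ?bad N) \<longlonglongrightarrow> 0"
      by (rule tendsto_add_zero)
    have "0 < a - (\<alpha> / \<nu> + 3 * (1 - \<alpha>) / \<mu>)"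
      using sum_less by simp
    then have "\<forall>\<^sub>F N::nat in sequentially. 1 \<le> (a - (\<alpha> / \<nu> + 3 * (1 - \<alpha>) / \<mu>)) * ln (real N)"
      by real_asymp
    then show "\<forall>\<^sub>F N in sequentially. outer_le (\<lambda>\<omega>. \<forall>n\<ge>N0. a * ln (real n) < real (typical_depth S U n \<omega>))
        (?hit N + ?bad N)"
      using eventually_ge_at_top[of "max 1 N0"]
    proof eventually_elim
      case (elim N)
      then have N: "1 \<le> N" "N0 \<le> N"
        by auto
      define k where "k = nat \<lfloor>\<alpha> / \<nu> * ln (real N)\<rfloor>"
      define L where "L = nat \<lceil>3 * (1 - \<alpha>) / \<mu> * ln (real N)\<rceil>"
      define w where "w = replicate k False"
      have "0 \<le> \<alpha> / \<nu> * ln (real N)"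
        using N \<alpha> \<nu>_pos by simp
      then have k: "real k \<le> \<alpha> / \<nu> * ln (real N)" "\<alpha> / \<nu> * ln (real N) - 1 \<le> real k"
        unfolding k_def by linarith+
      have "0 \<le> 3 * (1 - \<alpha>) / \<mu> * ln (real N)"
        using N \<alpha> \<mu>_pos by simp
      then have L: "real L \<le> 3 * (1 - \<alpha>) / \<mu> * ln (real N) + 1" "3 * (1 - \<alpha>) / \<mu> * ln (real N) \<le> real L"
        unfolding L_def by linarith+
      have kL: "real (k + L) \<le> a * ln (real N)"
        using k(1) L(1) elim(1) by (simp add: algebra_simps)
      have qk_ge: "real N powr (- \<alpha>) \<le> (1 - p) ^ k"
      proof -
        have "\<nu> * real k \<le> \<alpha> * ln (real N)"
          using mult_left_mono[OF k(1), of \<nu>] \<nu>_pos by simp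
        then show ?thesis
          unfolding q_power using N by (simp add: powr_def)
      qed
      have qk_le: "(1 - p) ^ k \<le> exp \<nu> * real N powr (- \<alpha>)"
      proof -
        have "\<alpha> * ln (real N) - \<nu> \<le> \<nu> * real k"
          using mult_left_mono[OF k(2), of \<nu>] \<nu>_pos by (simp add: algebra_simps)
        then show ?thesis
          unfolding q_power using N by (simp add: powr_def exp_add[symmetric])
      qed
      have pL_le: "p ^ L \<le> real N powr (- (3 * (1 - \<alpha>)))"
      proof -
        have "3 * (1 - \<alpha>) * ln (real N) \<le> \<mu> * real L"
          using mult_left_mono[OF L(2), of \<mu>] \<mu>_pos by simp
        then show ?thesis
          unfolding p_power using N by (simp add: powr_def algebra_simps)
      qed
      have hit: "outer_le (\<lambda>\<omega>. \<forall>n\<in>{N..<2 * N}. \<not> (U n \<omega> \<in> {1..N} \<and> S (U n \<omega>) \<omega> \<in> cylinder w)) (?hit N)"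
      proof (rule outer_le_mono[OF outer_le_no_hit[OF N(1)]])
        have "D * real N * real N powr (-\<alpha>) \<le> D * real N * word_prob p w"
          using qk_ge pos by (intro mult_left_mono) (auto simp: w_def)
        then show "exp (- ((1 - exp (- 1 / 2)) * real N * word_prob p w)) \<le> ?hit N"
          by (simp add: D_def mult_ac)
      qed simp
      define W where "W = (@) w ` {v. length v = L}"
      have W: "W \<subseteq> {v. length v = k + L}"
        by (auto simp: W_def w_def)
      have sum_W: "(\<Sum>v\<in>W. word_prob p v) = (1 - p) ^ k"
        unfolding W_def
        by (subst sum.reindex) (auto simp: w_def inj_on_def sum_distrib_left[symmetric] sum_word_prob)
      have W_le: "word_prob p v \<le> (1 - p) ^ k * p ^ L" if v: "v \<in> W" for v
        using v word_prob_le[OF half_less_p p_less_1] p_less_1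
        by (auto simp: W_def w_def intro!: mult_left_mono)
      let ?c = "exp \<nu> * real N powr (- \<alpha>)"
      have crowd: "outer_le (\<lambda>\<omega>. U (2 * N) \<omega> \<in> UNIV \<and> stake (k + L) (S i \<omega>) \<in> W \<and>
            1 \<le> card {j \<in> {1..2 * N} - {i}. stake (k + L) (S j \<omega>) = stake (k + L) (S i \<omega>)})
          (?c * (2 * real N * (?c * real N powr (- (3 * (1 - \<alpha>))))))"
        if i: "i \<in> {1..2 * N}" for i
      proof (rule outer_le_mono[OF outer_le_crowd_uniform[OF i W W_le]])
        have "(1 - p) ^ k * (2 * real N * ((1 - p) ^ k * p ^ L)) \<le>
            ?c * (2 * real N * (?c * real N powr (- (3 * (1 - \<alpha>)))))"
          using qk_le pL_le p_pos p_less_1 by (intro mult_mono) auto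
        then show "real (card (UNIV \<inter> {1..2 * N})) / real (2 * N) *
            (sum (word_prob p) W * (real (2 * N) * ((1 - p) ^ k * p ^ L)) ^ 1) \<le>
            ?c * (2 * real N * (?c * real N powr (- (3 * (1 - \<alpha>)))))"
          using N by (simp add: sum_W)
      qed auto
      have "outer_le (\<lambda>\<omega>. \<exists>i\<in>{1..2 * N}. U (2 * N) \<omega> \<in> UNIV \<and> stake (k + L) (S i \<omega>) \<in> W \<and>
            1 \<le> card {j \<in> {1..2 * N} - {i}. stake (k + L) (S j \<omega>) = stake (k + L) (S i \<omega>)})
          (\<Sum>i\<in>{1..2 * N}. ?c * (2 * real N * (?c * real N powr (- (3 * (1 - \<alpha>))))))"
        by (intro outer_le_Bex crowd) simp_all
      from outer_le_disj[OF hit this] show ?case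
      proof (rule outer_le_mono)
        have "(\<Sum>i\<in>{1..2 * N}. ?c * (2 * real N * (?c * real N powr (- (3 * (1 - \<alpha>)))))) =
            E * (real N powr 1 * real N powr 1 * real N powr (- \<alpha>) * real N powr (- \<alpha>) *
              real N powr (- (3 * (1 - \<alpha>))))"
          using N by (simp add: E_def)
        also have "\<dots> = ?bad N"
        proof -
          have "1 + 1 + - \<alpha> + - \<alpha> + - (3 * (1 - \<alpha>)) = \<alpha> - 1"
            by simp
          then show ?thesis
            by (simp only: powr_add[symmetric])
        qed
        finally show "?hit N + (\<Sum>i\<in>{1..2 * N}. ?c * (2 * real N * (?c * real N powr (- (3 * (1 - \<alpha>)))))) \<le>
            ?hit N + ?bad N"
          by simp
        show "AE \<omega> in M. (\<forall>n\<ge>N0. a * ln (real n) < real (typical_depth S U n \<omega>)) \<longrightarrow>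
            (\<forall>n\<in>{N..<2 * N}. \<not> (U n \<omega> \<in> {1..N} \<and> S (U n \<omega>) \<omega> \<in> cylinder w)) \<or>
            (\<exists>i\<in>{1..2 * N}. U (2 * N) \<omega> \<in> UNIV \<and> stake (k + L) (S i \<omega>) \<in> W \<and>
              1 \<le> card {j \<in> {1..2 * N} - {i}. stake (k + L) (S j \<omega>) = stake (k + L) (S i \<omega>)})"
          using AE_typical_depth
        proof eventually_elim
          case (elim \<omega>)
          show ?case
          proof (intro impI, rule ccontr)
            assume large: "\<forall>n\<ge>N0. a * ln (real n) < real (typical_depth S U n \<omega>)"
              and "\<not> ((\<forall>n\<in>{N..<2 * N}. \<not> (U n \<omega> \<in> {1..N} \<and> S (U n \<omega>) \<omega> \<in> cylinder w)) \<or>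
            (\<exists>i\<in>{1..2 * N}. U (2 * N) \<omega> \<in> UNIV \<and> stake (k + L) (S i \<omega>) \<in> W \<and>
              1 \<le> card {j \<in> {1..2 * N} - {i}. stake (k + L) (S j \<omega>) = stake (k + L) (S i \<omega>)}))"
            then obtain n where n: "n \<in> {N..<2 * N}" "U n \<omega> \<in> {1..N}" "S (U n \<omega>) \<omega> \<in> cylinder w"
              and good: "\<And>i. i \<in> {1..2 * N} \<Longrightarrow> stake (k + L) (S i \<omega>) \<in> W \<Longrightarrow>
                \<not> 1 \<le> card {j \<in> {1..2 * N} - {i}. stake (k + L) (S j \<omega>) = stake (k + L) (S i \<omega>)}"
              by blast
            let ?i = "U n \<omega>"
            have "stake (k + L) (S ?i \<omega>) = w @ stake L (sdrop k (S ?i \<omega>))"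
              using n(3) by (simp add: cylinder_def w_def stake_add[symmetric])
            then have "stake (k + L) (S ?i \<omega>) \<in> W"
              by (simp add: W_def)
            moreover have "?i \<in> {1..2 * N}"
              using n(2) by simp
            ultimately have "card {j \<in> {1..2 * N} - {?i}. stake (k + L) (S j \<omega>) = stake (k + L) (S ?i \<omega>)} = 0"
              using good[of ?i] by linarith
            moreover have "card {j \<in> {1..n} - {?i}. stake (k + L) (S j \<omega>) = stake (k + L) (S ?i \<omega>)} \<le>
                card {j \<in> {1..2 * N} - {?i}. stake (k + L) (S j \<omega>) = stake (k + L) (S ?i \<omega>)}"
              using n(1) by (intro card_mono) auto
            ultimately have "card (branch_levels (\<lambda>j. S j \<omega>) {1..n} ?i) \<le> k + L"
              using card_branch_levels_le[OF finite_atLeastAtMost[of 1 n], of "\<lambda>j. S j \<omega>" ?i "k + L"] by linarith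
            then have "typical_depth S U n \<omega> \<le> k + L"
              using elim n(1) N by auto
            then have "real (typical_depth S U n \<omega>) \<le> a * ln (real N)"
              using kL by linarith
            also have "\<dots> \<le> a * ln (real n)"
              using n(1) N \<open>0 < a\<close> by (intro mult_left_mono) auto
            also have "\<dots> < real (typical_depth S U n \<omega>)"
              using large n(1) N by auto
            finally show False
              by simp
          qed
        qed
      qed
    qed
  qed
  then have "AE \<omega> in M. \<forall>N0. \<not> (\<forall>n\<ge>N0. a * ln (real n) < real (typical_depth S U n \<omega>))"
    by (subst AE_all_countable) blast
  then show ?thesis
    by eventually_elim (simp add: frequently_def eventually_sequentially not_le)
qed

end

section \<open>Asymptotic equipartition\<close>

text \<open>The sum of the centred information contents of the bits of the word.\<close>

definition surplus :: "real \<Rightarrow> bool list \<Rightarrow> real" where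
  "surplus p w = - ln (word_prob p w) - bernoulli_entropy p * real (length w)"

lemma surplus_Cons:
  assumes "0 < p" "p < 1"
  shows "surplus p (b # w) = surplus p [b] + surplus p w"
  using assms word_prob_pos[OF assms, of w] by (auto simp: surplus_def ln_mult algebra_simps)

lemma surplus_bit_mean:
  assumes "0 < p" "p < 1"
  shows "p * surplus p [True] + (1 - p) * surplus p [False] = 0"
  by (simp add: surplus_def bernoulli_entropy_def algebra_simps)

lemma surplus_second_moment:
  assumes "0 < p" "p < 1"
  shows "(\<Sum>w | length w = L. word_prob p w * (surplus p w)\<^sup>2) =
    real L * (p * (surplus p [True])\<^sup>2 + (1 - p) * (surplus p [False])\<^sup>2)"
proof (induction L)
  case 0
  then show ?case
    by (simp add: surplus_def)
next
  case (Suc L)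
  let ?v = "p * (surplus p [True])\<^sup>2 + (1 - p) * (surplus p [False])\<^sup>2"
  have "word_prob p (True # w) * (surplus p (True # w))\<^sup>2 + word_prob p (False # w) * (surplus p (False # w))\<^sup>2 =
      word_prob p w * ?v + word_prob p w * (surplus p w)\<^sup>2
      + 2 * (p * surplus p [True] + (1 - p) * surplus p [False]) * (word_prob p w * surplus p w)" for w
    using surplus_Cons[OF assms, of True w] surplus_Cons[OF assms, of False w]
    by (simp add: power2_eq_square algebra_simps)
  then have "(\<Sum>w | length w = Suc L. word_prob p w * (surplus p w)\<^sup>2) =
      (\<Sum>w | length w = L. word_prob p w * ?v + word_prob p w * (surplus p w)\<^sup>2)"
    unfolding sum_words_Suc surplus_bit_mean[OF assms] by simp
  also have "\<dots> = ?v + (\<Sum>w | length w = L. word_prob p w * (surplus p w)\<^sup>2)"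
    by (simp add: sum.distrib sum_distrib_right[symmetric] sum_word_prob)
  finally show ?case
    using Suc by (simp add: algebra_simps)
qed

definition atypical :: "real \<Rightarrow> real \<Rightarrow> nat \<Rightarrow> bool list set" where
  "atypical p \<eta> L = {w. length w = L \<and> \<eta> * real L < \<bar>surplus p w\<bar>}"

text \<open>Chebyshev's inequality for the sum of centred independent terms, carried out on finite words.\<close>

lemma asymptotic_equipartition:
  assumes "0 < p" "p < 1" "0 < \<eta>"
  shows "(\<lambda>L. \<Sum>w\<in>atypical p \<eta> L. word_prob p w) \<longlonglongrightarrow> 0"
proof -
  define v where "v = p * (surplus p [True])\<^sup>2 + (1 - p) * (surplus p [False])\<^sup>2"
  have bound: "(\<Sum>w\<in>atypical p \<eta> L. word_prob p w) \<le> v / \<eta>\<^sup>2 / real L" if "1 \<le> L" for L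
  proof -
    have pos: "0 < (\<eta> * real L)\<^sup>2"
      using assms(3) that by simp
    have "(\<Sum>w\<in>atypical p \<eta> L. word_prob p w) * (\<eta> * real L)\<^sup>2 \<le>
        (\<Sum>w\<in>atypical p \<eta> L. word_prob p w * (surplus p w)\<^sup>2)"
      unfolding sum_distrib_right
    proof (intro sum_mono mult_left_mono word_prob_nonneg[OF assms(1,2)])
      fix w assume "w \<in> atypical p \<eta> L"
      then have "(\<eta> * real L)\<^sup>2 \<le> \<bar>surplus p w\<bar>\<^sup>2"
        using assms(3) by (intro power_mono) (auto simp: atypical_def)
      then show "(\<eta> * real L)\<^sup>2 \<le> (surplus p w)\<^sup>2"
        by simp
    qed
    also have "\<dots> \<le> (\<Sum>w | length w = L. word_prob p w * (surplus p w)\<^sup>2)"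
      by (intro sum_mono2) (auto simp: atypical_def intro!: mult_nonneg_nonneg word_prob_nonneg assms)
    also have "\<dots> = real L * v"
      by (simp add: surplus_second_moment assms v_def)
    finally have "(\<Sum>w\<in>atypical p \<eta> L. word_prob p w) \<le> real L * v / (\<eta> * real L)\<^sup>2"
      using pos by (simp add: pos_le_divide_eq)
    also have "\<dots> = v / \<eta>\<^sup>2 / real L"
      using that by (simp add: power2_eq_square)
    finally show ?thesis .
  qed
  show ?thesis
  proof (rule tendsto_sandwich)
    show "\<forall>\<^sub>F L in sequentially. 0 \<le> (\<Sum>w\<in>atypical p \<eta> L. word_prob p w)"
      by (intro always_eventually allI sum_nonneg word_prob_nonneg assms)
    show "\<forall>\<^sub>F L in sequentially. (\<Sum>w\<in>atypical p \<eta> L. word_prob p w) \<le> v / \<eta>\<^sup>2 / real L"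
      using eventually_ge_at_top[of 1] by eventually_elim (rule bound)
    show "(\<lambda>L. v / \<eta>\<^sup>2 / real L) \<longlonglongrightarrow> 0"
      by real_asymp
  qed simp
qed

section \<open>Lower and upper limits from rational thresholds\<close>

text \<open>With rational thresholds, only countably many almost sure statements have to be combined.
  The lower ones may be taken positive, as in the bounds on the depth.\<close>

lemma liminf_eqI:
  fixes x :: "nat \<Rightarrow> real"
  assumes "0 < c"
    and ev: "\<And>r. 0 < real_of_rat r \<Longrightarrow> real_of_rat r < c \<Longrightarrow> \<forall>\<^sub>F n in sequentially. real_of_rat r \<le> x n"
    and fr: "\<And>r. c < real_of_rat r \<Longrightarrow> \<exists>\<^sub>F n in sequentially. x n \<le> real_of_rat r"
  shows "liminf (\<lambda>n. ereal (x n)) = ereal c"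
proof (rule antisym)
  show "liminf (\<lambda>n. ereal (x n)) \<le> ereal c"
  proof (rule ccontr)
    assume "\<not> ?thesis"
    then obtain y where y: "ereal c < ereal y" "ereal y < liminf (\<lambda>n. ereal (x n))"
      using ereal_dense2[of "ereal c"] by (auto simp: not_le)
    then obtain r where r: "c < real_of_rat r" "real_of_rat r < y"
      using of_rat_dense[of c y] by auto
    have "\<forall>\<^sub>F n in sequentially. ereal y < ereal (x n)"
      using y(2) by (rule less_LiminfD)
    then have "\<forall>\<^sub>F n in sequentially. \<not> x n \<le> real_of_rat r"
      by eventually_elim (use r in simp)
    with fr[OF r(1)] show False
      by (simp add: frequently_def)
  qed
  show "ereal c \<le> liminf (\<lambda>n. ereal (x n))"
  proof (rule ccontr)
    assume "\<not> ?thesis"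
    then have "max 0 (liminf (\<lambda>n. ereal (x n))) < ereal c"
      using assms(1) by simp
    then obtain y where y: "max 0 (liminf (\<lambda>n. ereal (x n))) < ereal y" "ereal y < ereal c"
      using ereal_dense2 by blast
    then obtain r where r: "y < real_of_rat r" "real_of_rat r < c"
      using of_rat_dense[of y c] by auto
    have "0 < y"
      using y(1) by simp
    then have "0 < real_of_rat r"
      using r(1) by linarith
    then have "\<forall>\<^sub>F n in sequentially. ereal (real_of_rat r) \<le> ereal (x n)"
      using ev[OF _ r(2)] by simp
    then have "ereal (real_of_rat r) \<le> liminf (\<lambda>n. ereal (x n))"
      by (rule Liminf_bounded)
    then have "ereal y \<le> liminf (\<lambda>n. ereal (x n))"
      by (rule order_trans[rotated]) (use r in simp)
    moreover have "liminf (\<lambda>n. ereal (x n)) < ereal y"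
      using y(1) by simp
    ultimately show False
      by (simp add: not_le[symmetric])
  qed
qed

lemma limsup_eqI:
  fixes x :: "nat \<Rightarrow> real"
  assumes "0 < c"
    and ev: "\<And>r. c < real_of_rat r \<Longrightarrow> \<forall>\<^sub>F n in sequentially. x n \<le> real_of_rat r"
    and fr: "\<And>r. 0 < real_of_rat r \<Longrightarrow> real_of_rat r < c \<Longrightarrow> \<exists>\<^sub>F n in sequentially. real_of_rat r \<le> x n"
  shows "limsup (\<lambda>n. ereal (x n)) = ereal c"
proof (rule antisym)
  show "limsup (\<lambda>n. ereal (x n)) \<le> ereal c"
  proof (rule ccontr)
    assume "\<not> ?thesis"
    then obtain y where y: "ereal c < ereal y" "ereal y < limsup (\<lambda>n. ereal (x n))"
      using ereal_dense2[of "ereal c"] by (auto simp: not_le)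
    then obtain r where r: "c < real_of_rat r" "real_of_rat r < y"
      using of_rat_dense[of c y] by auto
    have "\<forall>\<^sub>F n in sequentially. ereal (x n) \<le> ereal (real_of_rat r)"
      using ev[OF r(1)] by simp
    then have "limsup (\<lambda>n. ereal (x n)) \<le> ereal (real_of_rat r)"
      by (rule Limsup_bounded)
    also have "\<dots> < ereal y"
      using r by simp
    finally show False
      using y(2) by simp
  qed
  show "ereal c \<le> limsup (\<lambda>n. ereal (x n))"
  proof (rule ccontr)
    assume "\<not> ?thesis"
    then have "max 0 (limsup (\<lambda>n. ereal (x n))) < ereal c"
      using assms(1) by simp
    then obtain y where y: "max 0 (limsup (\<lambda>n. ereal (x n))) < ereal y" "ereal y < ereal c"
      using ereal_dense2 by blast
    then obtain r where r: "y < real_of_rat r" "real_of_rat r < c"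
      using of_rat_dense[of y c] by auto
    have "0 < y" "limsup (\<lambda>n. ereal (x n)) < ereal y"
      using y(1) by simp_all
    then have "\<forall>\<^sub>F n in sequentially. ereal (x n) < ereal y"
      by (intro Limsup_lessD)
    then have "\<forall>\<^sub>F n in sequentially. \<not> real_of_rat r \<le> x n"
      by eventually_elim (use r in simp)
    moreover have "0 < real_of_rat r"
      using \<open>0 < y\<close> r(1) by linarith
    ultimately show False
      using fr[OF _ r(2)] by (simp add: frequently_def)
  qed
qed

context biased_patricia
begin

section \<open>Limits of the normalised typical depth\<close>

lemma entropy_pos: "0 < bernoulli_entropy p"
proof -
  have "0 < p * - ln p" "0 < (1 - p) * - ln (1 - p)"
    using p_pos p_less_1 by (intro mult_pos_pos; simp)+
  then show ?thesis
    by (simp add: bernoulli_entropy_def)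
qed

lemma word_prob_typical:
  assumes "length w = L" "w \<notin> atypical p \<eta> L"
  shows "word_prob p w \<le> exp (- (bernoulli_entropy p - \<eta>) * real L)"
    and "exp (- (bernoulli_entropy p + \<eta>) * real L) \<le> word_prob p w"
proof -
  have "\<bar>surplus p w\<bar> \<le> \<eta> * real L"
    using assms by (auto simp: atypical_def)
  then have ln: "ln (word_prob p w) \<le> - (bernoulli_entropy p - \<eta>) * real L"
      "- (bernoulli_entropy p + \<eta>) * real L \<le> ln (word_prob p w)"
    using assms(1) by (auto simp: surplus_def abs_le_iff algebra_simps)
  have "word_prob p w = exp (ln (word_prob p w))"
    using wp_pos by simp
  with ln show "word_prob p w \<le> exp (- (bernoulli_entropy p - \<eta>) * real L)"
    "exp (- (bernoulli_entropy p + \<eta>) * real L) \<le> word_prob p w"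
    by (metis exp_le_cancel_iff)+
qed

text \<open>A typical word of length \<open>L = a * ln n\<close> with \<open>a > 1 / h\<close>, where \<open>h\<close> is the entropy, has
  probability below \<open>1 / n\<close> by a positive power of \<open>n\<close>, so a single companion is already unlikely.\<close>

lemma outer_le_depth_gt_vanishes:
  assumes "1 / bernoulli_entropy p < a"
  obtains b where "b \<longlonglongrightarrow> 0"
    and "\<And>n. 1 \<le> n \<Longrightarrow> outer_le (\<lambda>\<omega>. a * ln (real n) < real (typical_depth S U n \<omega>)) (b n)"
proof -
  let ?h = "bernoulli_entropy p"
  have h: "0 < ?h"
    by (rule entropy_pos)
  have "0 < a"
    using assms h by (meson less_trans zero_less_divide_1_iff)
  have "1 / a < ?h"
    using assms h \<open>0 < a\<close> by (simp add: field_simps)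
  then obtain g where g: "1 / a < g" "g < ?h"
    using dense by blast
  define \<eta> where "\<eta> = ?h - g"
  have \<eta>: "0 < \<eta>" "?h - \<eta> = g"
    using g by (simp_all add: \<eta>_def)
  have "0 < g"
    using g(1) \<open>0 < a\<close> by (meson less_trans zero_less_divide_1_iff)
  have ga: "1 < g * a"
    using g(1) \<open>0 < a\<close> by (simp add: field_simps)
  define L where "L n = nat \<lfloor>a * ln (real n)\<rfloor>" for n :: nat
  define b where "b n = (\<Sum>w\<in>atypical p \<eta> (L n). word_prob p w) + exp g * (real n * (1 * real n powr (- (g * a))))" for n
  have "filterlim L sequentially sequentially"
    unfolding L_def using \<open>0 < a\<close> by real_asymp
  then have "(\<lambda>n. \<Sum>w\<in>atypical p \<eta> (L n). word_prob p w) \<longlonglongrightarrow> 0"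
    by (rule filterlim_compose[OF asymptotic_equipartition[OF p_pos p_less_1 \<eta>(1)]])
  moreover have "(\<lambda>n. exp g * (real n * (1 * real n powr (- (g * a))))) \<longlonglongrightarrow> 0"
    using ga by real_asymp
  ultimately have "b \<longlonglongrightarrow> 0"
    unfolding b_def by (rule tendsto_add_zero)
  moreover have "outer_le (\<lambda>\<omega>. a * ln (real n) < real (typical_depth S U n \<omega>)) (b n)" if n: "1 \<le> n" for n
  proof -
    have L: "a * ln (real n) - 1 \<le> real (L n)"
      unfolding L_def by linarith
    define c where "c = exp (- g * real (L n))"
    have "c \<le> exp (- g * (a * ln (real n) - 1))"
      unfolding c_def using L \<open>0 < g\<close> by simp
    also have "\<dots> = exp g * real n powr (- (g * a))"
      using n by (simp add: powr_def exp_add[symmetric] algebra_simps)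
    finally have c: "c \<le> exp g * real n powr (- (g * a))" .
    let ?W = "{w. length w = L n} - atypical p \<eta> (L n)"
    have A: "outer_le (\<lambda>\<omega>. stake (L n) (S (U n \<omega>) \<omega>) \<in> atypical p \<eta> (L n)) (\<Sum>w\<in>atypical p \<eta> (L n). word_prob p w)"
      using n by (intro outer_le_prefix) (auto simp: atypical_def)
    have B: "outer_le (\<lambda>\<omega>. stake (L n) (S (U n \<omega>) \<omega>) \<in> ?W \<and> L n + 1 \<le> typical_depth S U n \<omega>) ((real n * c) ^ 1)"
      using n word_prob_typical(1)[of _ "L n" \<eta>] unfolding \<eta>(2)
      by (intro outer_le_depth_ge) (auto simp: c_def)
    from outer_le_disj[OF A B] show ?thesis
    proof (rule outer_le_mono)
      show "(\<Sum>w\<in>atypical p \<eta> (L n). word_prob p w) + (real n * c) ^ 1 \<le> b n"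
        using mult_left_mono[OF c, of "real n"] by (simp add: b_def mult_ac)
      have "0 \<le> a * ln (real n)"
        using n \<open>0 < a\<close> by simp
      then have "L n + 1 \<le> typical_depth S U n \<omega>" if "a * ln (real n) < real (typical_depth S U n \<omega>)" for \<omega>
        using that unfolding L_def by linarith
      then show "AE \<omega> in M. a * ln (real n) < real (typical_depth S U n \<omega>) \<longrightarrow>
          stake (L n) (S (U n \<omega>) \<omega>) \<in> atypical p \<eta> (L n) \<or>
          (stake (L n) (S (U n \<omega>) \<omega>) \<in> ?W \<and> L n + 1 \<le> typical_depth S U n \<omega>)"
        by auto
    qed
  qed
  ultimately show ?thesis
    by (rule that)
qed

text \<open>A typical word of length \<open>k = a * ln n\<close> with \<open>a < 1 / h\<close> is the prefix of a positive power of
  \<open>n\<close> many strings on average, so that all levels up to \<open>k\<close> branch.\<close>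

lemma outer_le_depth_less_vanishes:
  assumes "0 < a" "a < 1 / bernoulli_entropy p"
  obtains b where "b \<longlonglongrightarrow> 0"
    and "\<And>n. 1 \<le> n \<Longrightarrow> outer_le (\<lambda>\<omega>. real (typical_depth S U n \<omega>) < a * ln (real n)) (b n)"
proof -
  let ?h = "bernoulli_entropy p"
  have h: "0 < ?h"
    by (rule entropy_pos)
  have "?h < 1 / a"
    using assms h by (simp add: field_simps)
  then obtain g where g: "?h < g" "g < 1 / a"
    using dense by blast
  define \<eta> where "\<eta> = g - ?h"
  have \<eta>: "0 < \<eta>" "?h + \<eta> = g"
    using g by (simp_all add: \<eta>_def)
  have "0 < g"
    using g(1) h by simp
  define \<beta> where "\<beta> = g * a"
  have \<beta>: "0 < \<beta>" "\<beta> < 1"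
    using g(2) assms(1) \<open>0 < g\<close> by (simp_all add: \<beta>_def field_simps)
  define C where "C = (1 - p) * exp (- g)"
  have "0 < C"
    using p_less_1 by (simp add: C_def)
  define k where "k n = nat \<lceil>a * ln (real n)\<rceil>" for n :: nat
  define b where "b n = (\<Sum>w\<in>atypical p \<eta> (k n). word_prob p w) +
      (a * ln (real n) + 1) * exp (- ((real n - 1) * (C * real n powr (-\<beta>))))" for n
  have "filterlim k sequentially sequentially"
    unfolding k_def using \<open>0 < a\<close> by real_asymp
  then have "(\<lambda>n. \<Sum>w\<in>atypical p \<eta> (k n). word_prob p w) \<longlonglongrightarrow> 0"
    by (rule filterlim_compose[OF asymptotic_equipartition[OF p_pos p_less_1 \<eta>(1)]])
  moreover have "(\<lambda>n. (a * ln (real n) + 1) * exp (- ((real n - 1) * (C * real n powr (-\<beta>))))) \<longlonglongrightarrow> 0"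
    using \<beta> \<open>0 < C\<close> assms(1) by real_asymp
  ultimately have "b \<longlonglongrightarrow> 0"
    unfolding b_def by (rule tendsto_add_zero)
  moreover have "outer_le (\<lambda>\<omega>. real (typical_depth S U n \<omega>) < a * ln (real n)) (b n)" if n: "1 \<le> n" for n
  proof -
    have "0 \<le> a * ln (real n)"
      using n assms(1) by simp
    then have k: "real (k n) \<le> a * ln (real n) + 1"
      unfolding k_def by linarith
    define c where "c = exp (- g) * real n powr (- \<beta>)"
    have "c = exp (- g * (a * ln (real n) + 1))"
      using n by (simp add: c_def \<beta>_def powr_def exp_add[symmetric] algebra_simps)
    also have "\<dots> \<le> exp (- g * real (k n))"
      using k \<open>0 < g\<close> by simp
    finally have c: "c \<le> exp (- g * real (k n))" .
    let ?W = "{w. length w = k n} - atypical p \<eta> (k n)"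
    have A: "outer_le (\<lambda>\<omega>. stake (k n) (S (U n \<omega>) \<omega>) \<in> atypical p \<eta> (k n)) (\<Sum>w\<in>atypical p \<eta> (k n). word_prob p w)"
      using n by (intro outer_le_prefix) (auto simp: atypical_def)
    have B: "outer_le (\<lambda>\<omega>. stake (k n) (S (U n \<omega>) \<omega>) \<in> ?W \<and> typical_depth S U n \<omega> < k n)
        (real (k n) * exp (- (real (n - 1) * ((1 - p) * c))))"
    proof (rule outer_le_depth_less[OF n])
      fix w assume "w \<in> ?W"
      then show "c \<le> word_prob p w"
        using word_prob_typical(2)[of w "k n" \<eta>] c unfolding \<eta>(2) by auto
    qed auto
    from outer_le_disj[OF A B] show ?thesis
    proof (rule outer_le_mono)
      have "real (k n) * exp (- (real (n - 1) * ((1 - p) * c))) \<le>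
          (a * ln (real n) + 1) * exp (- ((real n - 1) * (C * real n powr (-\<beta>))))"
        using k n by (intro mult_mono) (auto simp: C_def c_def of_nat_diff mult_ac)
      then show "(\<Sum>w\<in>atypical p \<eta> (k n). word_prob p w) + real (k n) * exp (- (real (n - 1) * ((1 - p) * c))) \<le> b n"
        by (simp add: b_def)
      have "typical_depth S U n \<omega> < k n" if "real (typical_depth S U n \<omega>) < a * ln (real n)" for \<omega>
        using that unfolding k_def by linarith
      then show "AE \<omega> in M. real (typical_depth S U n \<omega>) < a * ln (real n) \<longrightarrow>
          stake (k n) (S (U n \<omega>) \<omega>) \<in> atypical p \<eta> (k n) \<or>
          (stake (k n) (S (U n \<omega>) \<omega>) \<in> ?W \<and> typical_depth S U n \<omega> < k n)"
        by auto
    qed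
  qed
  ultimately show ?thesis
    by (rule that)
qed

lemma depth_measurable: "(\<lambda>\<omega>. real (typical_depth S U n \<omega>) / ln (real n)) \<in> borel_measurable M"
  by (rule measurable_compose[OF typical_depth_measurable]) simp

lemma depth_converges_in_probability:
  "converges_in_probability M (\<lambda>n \<omega>. real (typical_depth S U n \<omega>) / ln (real n)) (1 / bernoulli_entropy p)"
  unfolding converges_in_probability_def
proof (intro conjI allI impI depth_measurable)
  fix \<epsilon> :: real assume "0 < \<epsilon>"
  let ?h = "bernoulli_entropy p" and ?D = "typical_depth S U"
  let ?E = "\<lambda>n. {\<omega> \<in> space M. \<bar>real (?D n \<omega>) / ln (real n) - 1 / ?h\<bar> > \<epsilon>}"
  define \<delta> where "\<delta> = min \<epsilon> (1 / ?h / 2)"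
  have \<delta>: "0 < \<delta>" "\<delta> \<le> \<epsilon>" "\<delta> < 1 / ?h"
    using \<open>0 < \<epsilon>\<close> entropy_pos by (auto simp: \<delta>_def min_def field_simps)
  \<comment> \<open>\<open>\<delta>\<close> is also below \<open>1 / h\<close>, so that the lower threshold \<open>1 / h - \<delta>\<close> is positive\<close>
  obtain b where b: "b \<longlonglongrightarrow> 0"
    "\<And>n. 1 \<le> n \<Longrightarrow> outer_le (\<lambda>\<omega>. (1 / ?h + \<delta>) * ln (real n) < real (?D n \<omega>)) (b n)"
    using outer_le_depth_gt_vanishes[of "1 / ?h + \<delta>"] \<delta>(1) by auto
  obtain b' where b': "b' \<longlonglongrightarrow> 0"
    "\<And>n. 1 \<le> n \<Longrightarrow> outer_le (\<lambda>\<omega>. real (?D n \<omega>) < (1 / ?h - \<delta>) * ln (real n)) (b' n)"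
    using outer_le_depth_less_vanishes[of "1 / ?h - \<delta>"] \<delta> by auto
  have le: "prob (?E n) \<le> b n + b' n" if n: "2 \<le> n" for n
  proof (rule prob_le_of_outer_le)
    have "1 \<le> n"
      using n by simp
    from outer_le_disj[OF b(2)[OF this] b'(2)[OF this]]
    show "outer_le (\<lambda>\<omega>. \<bar>real (?D n \<omega>) / ln (real n) - 1 / ?h\<bar> > \<epsilon>) (b n + b' n)"
    proof (rule outer_le_mono)
      have "(1 / ?h + \<delta>) * ln (real n) < real (?D n \<omega>) \<or> real (?D n \<omega>) < (1 / ?h - \<delta>) * ln (real n)"
        if "\<bar>real (?D n \<omega>) / ln (real n) - 1 / ?h\<bar> > \<epsilon>" for \<omega>
      proof -
        have "1 / ?h + \<delta> < real (?D n \<omega>) / ln (real n) \<or> real (?D n \<omega>) / ln (real n) < 1 / ?h - \<delta>"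
          using that \<delta>(2) by linarith
        then show ?thesis
          using n by (simp add: pos_less_divide_eq pos_divide_less_eq)
      qed
      then show "AE \<omega> in M. \<epsilon> < \<bar>real (?D n \<omega>) / ln (real n) - 1 / ?h\<bar> \<longrightarrow>
          (1 / ?h + \<delta>) * ln (real n) < real (?D n \<omega>) \<or> real (?D n \<omega>) < (1 / ?h - \<delta>) * ln (real n)"
        by auto
    qed simp
    show "?E n \<in> events"
      using depth_measurable[of n] by measurable
  qed
  show "(\<lambda>n. prob (?E n)) \<longlonglongrightarrow> 0"
  proof (rule tendsto_sandwich[where f = "\<lambda>_. 0" and h = "\<lambda>n. b n + b' n"])
    show "\<forall>\<^sub>F n in sequentially. prob (?E n) \<le> b n + b' n"
      using eventually_ge_at_top[of 2] by eventually_elim (rule le)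
    show "(\<lambda>n. b n + b' n) \<longlonglongrightarrow> 0"
      using b(1) b'(1) by (rule tendsto_add_zero)
  qed simp_all
qed

lemma AE_liminf_depth:
  "AE \<omega> in M. liminf (\<lambda>n. ereal (real (typical_depth S U n \<omega>) / ln (real n))) = ereal (1 / \<nu>)"
proof -
  have "AE \<omega> in M. 0 < real_of_rat r \<longrightarrow> real_of_rat r < 1 / \<nu> \<longrightarrow>
      (\<forall>\<^sub>F n in sequentially. \<not> real (typical_depth S U n \<omega>) < real_of_rat r * ln (real n))" for r
    by (cases "0 < real_of_rat r \<and> real_of_rat r < 1 / \<nu>") (auto simp: AE_eventually_depth_ge)
  then have ev: "AE \<omega> in M. \<forall>r. 0 < real_of_rat r \<longrightarrow> real_of_rat r < 1 / \<nu> \<longrightarrow>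
      (\<forall>\<^sub>F n in sequentially. \<not> real (typical_depth S U n \<omega>) < real_of_rat r * ln (real n))"
    by (subst AE_all_countable) blast
  have "AE \<omega> in M. 1 / \<nu> < real_of_rat r \<longrightarrow>
      (\<exists>\<^sub>F n in sequentially. real (typical_depth S U n \<omega>) \<le> real_of_rat r * ln (real n))" for r
    by (cases "1 / \<nu> < real_of_rat r") (auto simp: AE_frequently_depth_le)
  then have fr: "AE \<omega> in M. \<forall>r. 1 / \<nu> < real_of_rat r \<longrightarrow>
      (\<exists>\<^sub>F n in sequentially. real (typical_depth S U n \<omega>) \<le> real_of_rat r * ln (real n))"
    by (subst AE_all_countable) blast
  from ev fr show ?thesis
  proof eventually_elim
    case (elim \<omega>)
    show ?case
    proof (rule liminf_eqI)
      show "0 < 1 / \<nu>"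
        using \<nu>_pos by simp
      fix r :: rat
      show "\<forall>\<^sub>F n in sequentially. real_of_rat r \<le> real (typical_depth S U n \<omega>) / ln (real n)"
        if "0 < real_of_rat r" "real_of_rat r < 1 / \<nu>"
        using elim(1)[rule_format, OF that] eventually_ge_at_top[of 2]
        by eventually_elim (simp add: pos_le_divide_eq not_less)
      show "\<exists>\<^sub>F n in sequentially. real (typical_depth S U n \<omega>) / ln (real n) \<le> real_of_rat r"
        if "1 / \<nu> < real_of_rat r"
        using frequently_eventually_frequently[OF elim(2)[rule_format, OF that] eventually_ge_at_top[of 2]]
        by (rule frequently_elim1) (simp add: pos_divide_le_eq)
    qed
  qed
qed

lemma AE_limsup_depth:
  "AE \<omega> in M. limsup (\<lambda>n. ereal (real (typical_depth S U n \<omega>) / ln (real n))) = ereal (1 / \<mu>)"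
proof -
  have "AE \<omega> in M. 1 / \<mu> < real_of_rat r \<longrightarrow>
      (\<forall>\<^sub>F n in sequentially. \<not> real_of_rat r * ln (real n) \<le> real (typical_depth S U n \<omega>))" for r
    by (cases "1 / \<mu> < real_of_rat r") (auto simp: AE_eventually_depth_less)
  then have ev: "AE \<omega> in M. \<forall>r. 1 / \<mu> < real_of_rat r \<longrightarrow>
      (\<forall>\<^sub>F n in sequentially. \<not> real_of_rat r * ln (real n) \<le> real (typical_depth S U n \<omega>))"
    by (subst AE_all_countable) blast
  have "AE \<omega> in M. 0 < real_of_rat r \<longrightarrow> real_of_rat r < 1 / \<mu> \<longrightarrow>
      (\<exists>\<^sub>F n in sequentially. real_of_rat r * ln (real n) \<le> real (typical_depth S U n \<omega>))" for r
    by (cases "0 < real_of_rat r \<and> real_of_rat r < 1 / \<mu>") (auto simp: AE_frequently_depth_ge)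
  then have fr: "AE \<omega> in M. \<forall>r. 0 < real_of_rat r \<longrightarrow> real_of_rat r < 1 / \<mu> \<longrightarrow>
      (\<exists>\<^sub>F n in sequentially. real_of_rat r * ln (real n) \<le> real (typical_depth S U n \<omega>))"
    by (subst AE_all_countable) blast
  from ev fr show ?thesis
  proof eventually_elim
    case (elim \<omega>)
    show ?case
    proof (rule limsup_eqI)
      show "0 < 1 / \<mu>"
        using \<mu>_pos by simp
      fix r :: rat
      show "\<forall>\<^sub>F n in sequentially. real (typical_depth S U n \<omega>) / ln (real n) \<le> real_of_rat r"
        if "1 / \<mu> < real_of_rat r"
        using elim(1)[rule_format, OF that] eventually_ge_at_top[of 2]
        by eventually_elim (simp add: pos_divide_le_eq not_le less_imp_le)
      show "\<exists>\<^sub>F n in sequentially. real_of_rat r \<le> real (typical_depth S U n \<omega>) / ln (real n)"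
        if "0 < real_of_rat r" "real_of_rat r < 1 / \<mu>"
        using frequently_eventually_frequently[OF elim(2)[rule_format, OF that] eventually_ge_at_top[of 2]]
        by (rule frequently_elim1) (simp add: pos_le_divide_eq)
    qed
  qed
qed

lemma not_AE_convergent_depth:
  "\<not> (AE \<omega> in M. convergent (\<lambda>n. real (typical_depth S U n \<omega>) / ln (real n)))"
proof
  assume "AE \<omega> in M. convergent (\<lambda>n. real (typical_depth S U n \<omega>) / ln (real n))"
  then have "AE \<omega> in M. False"
    using AE_liminf_depth AE_limsup_depth
  proof eventually_elim
    case (elim \<omega>)
    then obtain l where "(\<lambda>n. real (typical_depth S U n \<omega>) / ln (real n)) \<longlonglongrightarrow> l"
      by (auto simp: convergent_def)
    then have "(\<lambda>n. ereal (real (typical_depth S U n \<omega>) / ln (real n))) \<longlonglongrightarrow> ereal l"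
      by simp
    then have "liminf (\<lambda>n. ereal (real (typical_depth S U n \<omega>) / ln (real n))) =
        limsup (\<lambda>n. ereal (real (typical_depth S U n \<omega>) / ln (real n)))"
      using lim_imp_Liminf[OF trivial_limit_sequentially] lim_imp_Limsup[OF trivial_limit_sequentially] by metis
    then have "1 / \<nu> = 1 / \<mu>"
      using elim by simp
    then show False
      using \<mu>_less_\<nu> by simp
  qed
  then show False
    by simp
qed

end

theorem theorem3:
  fixes M :: "'a measure" and p q :: real
    and S :: "nat \<Rightarrow> 'a \<Rightarrow> bool stream" and U :: "nat \<Rightarrow> 'a \<Rightarrow> nat"
    and D :: "nat \<Rightarrow> 'a \<Rightarrow> nat"
  assumes "1 / 2 < p" and "p < 1" and "q = 1 - p"
    and "random_patricia M p S U"
    and "D = typical_depth S U"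
  shows "converges_in_probability M (\<lambda>n \<omega>. real (D n \<omega>) / ln (real n)) (1 / bernoulli_entropy p)
    \<and> \<not> (AE \<omega> in M. convergent (\<lambda>n. real (D n \<omega>) / ln (real n)))
    \<and> (AE \<omega> in M. liminf (\<lambda>n. ereal (real (D n \<omega>) / ln (real n))) = ereal (1 / ln (1 / q)))
    \<and> (AE \<omega> in M. limsup (\<lambda>n. ereal (real (D n \<omega>) / ln (real n))) = ereal (1 / ln (1 / p)))"
proof -
  interpret random_patricia M p S U
    by fact
  interpret biased_patricia M p S U
    by unfold_locales fact+
  show ?thesis
    unfolding assms(3,5)
    using depth_converges_in_probability not_AE_convergent_depth AE_liminf_depth AE_limsup_depth
    unfolding \<mu>_def \<nu>_def by blast
qed

end
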